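(* Let $G$ be a countably infinite sofic group, let $\Sigma=(\sigma_j:G\to\operatorname{Sym}(d_j))_{j\geq 1}$ be a fixed sofic approximation to $G$, and let $G\curvearrowright X$ be a continuous action on a compact metrizable space $X$ with compatible metric $\rho$. If the topological sofic entropy satisfies $h^{\mathrm{top}}_\Sigma(X,G)>0$, then there exists $\delta>0$ such that, for every sequence $\mathbf{s}=(s_i)_{i\geq 1}$ of pairwise distinct elements of $G$, there is a Cantor set $K_{\mathbf{s}}\subseteq X$ for which every two distinct points $x,x'\in K_{\mathbf{s}}$ satisfy \[ \liminf_{i\to\infty}\rho(s_i x,s_i x')=0,\qquad \limsup_{i\to\infty}\rho(s_i x,s_i x')>\delta . \] (The constant $\delta$ is independent of the sequence $\mathbf{s}$.)
   Context: $G$ is a discrete group. A Cantor set in $X$ is a subset homeomorphic to the standard Cantor set. Sofic approximation. $\operatorname{Sym}(d)$ is the symmetric group of $\{1,\dots,d\}$ with the normalized Hamming metric $d_{\mathrm{Hamm}}(\tau,\omega)=\frac1d|\{v:\tau(v)\neq\omega(v)\}|$. A sequence of maps $\Sigma=(\sigma_j:G\to\operatorname{Sym}(d_j))_{j\ge1}$ with $d_j\to\infty$ is a sofic approximation to $G$ if $\lim_{j}d_{\mathrm{Hamm}}(\sigma_j(st),\sigma_j(s)\sigma_j(t))=0$ for all $s,t\in G$ and $\lim_j d_{\mathrm{Hamm}}(\sigma_j(s),\sigma_j(t))=1$ for all distinct $s,t\in G$. A countable group is sofic if it admits a sofic approximation. Topological sofic entropy (Kerr--Li, in the standard spatial form).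 For maps $\varphi,\psi:\{1,\dots,d\}\to X$ put $\rho_2(\varphi,\psi)=\bigl(\frac1d\sum_{v=1}^d\rho(\varphi(v),\psi(v))^2\bigr)^{1/2}$ and $\rho_\infty(\varphi,\psi)=\max_{v}\rho(\varphi(v),\psi(v))$. For a finite set $F\subseteq G$, $\eta>0$ and $\sigma:G\to\operatorname{Sym}(d)$, let $\mathrm{Map}(\rho,F,\eta,\sigma)$ be the set of maps $\varphi:\{1,\dots,d\}\to X$ such that $\rho_2(\varphi\circ\sigma(s),\,s\varphi)<\eta$ for all $s\in F$, where $(s\varphi)(v)=s\cdot\varphi(v)$. Let $N_\varepsilon(\cdot,\rho_\infty)$ denote the maximal cardinality of a subset whose distinct points are at $\rho_\infty$-distance at least $\varepsilon$. Then \[ h^{\mathrm{top}}_\Sigma(X,G)=\sup_{\varepsilon>0}\ \inf_{F}\ \inf_{\eta>0}\ \limsup_{j\to\infty}\frac1{d_j}\log N_\varepsilon(\mathrm{Map}(\rho,F,\eta,\sigma_j),\rho_\infty)\in\{-\infty\}\cup[0,\infty], \] where $F$ ranges over nonempty finite subsets of $G$ and $\log 0=-\infty$. This value does not depend on the compatible metric $\rho$. *)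

theory Defs
  imports "HOL-Analysis.Analysis" "HOL-Algebra.Group_Action" "HOL-Algebra.Sym_Groups"
begin

definition hamming_dist :: "nat \<Rightarrow> (nat \<Rightarrow> nat) \<Rightarrow> (nat \<Rightarrow> nat) \<Rightarrow> real" where
  "hamming_dist d \<tau> \<omega> = real (card {v \<in> {1..d}. \<tau> v \<noteq> \<omega> v}) / real d"

definition sofic_approximation ::
    "('g, 'm) monoid_scheme \<Rightarrow> (nat \<Rightarrow> nat) \<Rightarrow> (nat \<Rightarrow> 'g \<Rightarrow> nat \<Rightarrow> nat) \<Rightarrow> bool" where
  "sofic_approximation G d \<sigma> \<longleftrightarrow>
     (\<forall>j. 0 < d j) \<and>
     (\<forall>j. \<sigma> j \<in> carrier G \<rightarrow> carrier (sym_group (d j))) \<and>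
     filterlim d at_top sequentially \<and>
     (\<forall>s\<in>carrier G. \<forall>t\<in>carrier G.
        (\<lambda>j. hamming_dist (d j) (\<sigma> j (s \<otimes>\<^bsub>G\<^esub> t)) (\<sigma> j s \<circ> \<sigma> j t)) \<longlonglongrightarrow> 0) \<and>
     (\<forall>s\<in>carrier G. \<forall>t\<in>carrier G. s \<noteq> t \<longrightarrow>
        (\<lambda>j. hamming_dist (d j) (\<sigma> j s) (\<sigma> j t)) \<longlonglongrightarrow> 1)"

definition sofic_group :: "('g, 'm) monoid_scheme \<Rightarrow> bool" where
  "sofic_group G \<longleftrightarrow> group G \<and> countable (carrier G) \<and> (\<exists>d \<sigma>. sofic_approximation G d \<sigma>)"

definition rho_2 :: "nat \<Rightarrow> (nat \<Rightarrow> 'x::metric_space) \<Rightarrow> (nat \<Rightarrow> 'x) \<Rightarrow> real" where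
  "rho_2 d \<phi> \<psi> = sqrt ((\<Sum>v=1..d. (dist (\<phi> v) (\<psi> v))\<^sup>2) / real d)"

definition rho_inf :: "nat \<Rightarrow> (nat \<Rightarrow> 'x::metric_space) \<Rightarrow> (nat \<Rightarrow> 'x) \<Rightarrow> real" where
  "rho_inf d \<phi> \<psi> = Max ((\<lambda>v. dist (\<phi> v) (\<psi> v)) ` {1..d})"

text \<open>The models are extensional functions, so that distinct elements really are distinct
  maps from \<open>{1..d}\<close> to \<open>X\<close>.  Here \<open>\<sigma>\<close> is a single map into \<open>Sym(d)\<close>.\<close>

definition sofic_Map ::
    "'x::metric_space set \<Rightarrow> ('g \<Rightarrow> 'x \<Rightarrow> 'x) \<Rightarrow> 'g set \<Rightarrow> real \<Rightarrow> nat \<Rightarrow> ('g \<Rightarrow> nat \<Rightarrow> nat)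
      \<Rightarrow> (nat \<Rightarrow> 'x) set" where
  "sofic_Map X act F \<eta> d \<sigma> =
     {\<phi> \<in> {1..d} \<rightarrow>\<^sub>E X. \<forall>s\<in>F. rho_2 d (\<phi> \<circ> \<sigma> s) (\<lambda>v. act s (\<phi> v)) < \<eta>}"

text \<open>Infinite if there are arbitrarily large finite separated subsets (which does not occur
  for models in a compact space); otherwise the supremum is attained.\<close>

definition separated_number :: "('a \<Rightarrow> 'a \<Rightarrow> real) \<Rightarrow> real \<Rightarrow> 'a set \<Rightarrow> enat" where
  "separated_number r \<epsilon> A =
     (SUP S \<in> {S. finite S \<and> S \<subseteq> A \<and> pairwise (\<lambda>x y. \<epsilon> \<le> r x y) S}. enat (card S))"

definition log_enat :: "enat \<Rightarrow> ereal" where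
  "log_enat n = (case n of enat k \<Rightarrow> if k = 0 then -\<infinity> else ereal (ln (real k)) | \<infinity> \<Rightarrow> \<infinity>)"

definition sofic_top_entropy ::
    "('g, 'm) monoid_scheme \<Rightarrow> (nat \<Rightarrow> nat) \<Rightarrow> (nat \<Rightarrow> 'g \<Rightarrow> nat \<Rightarrow> nat)
      \<Rightarrow> 'x::metric_space set \<Rightarrow> ('g \<Rightarrow> 'x \<Rightarrow> 'x) \<Rightarrow> ereal" where
  "sofic_top_entropy G d \<sigma> X act =
     (SUP \<epsilon> \<in> {0<..}. INF F \<in> {F. finite F \<and> F \<noteq> {} \<and> F \<subseteq> carrier G}. INF \<eta> \<in> {0<..}.
        limsup (\<lambda>j. ereal (1 / real (d j)) *
          log_enat (separated_number (rho_inf (d j)) \<epsilon> (sofic_Map X act F \<eta> (d j) (\<sigma> j)))))"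

text \<open>An action is a homomorphism into the bijections of \<open>X\<close>; \<open>G\<close> is discrete, so joint
  continuity amounts to continuity of each \<open>act g\<close>.\<close>

definition continuous_action ::
    "('g, 'm) monoid_scheme \<Rightarrow> 'x::topological_space set \<Rightarrow> ('g \<Rightarrow> 'x \<Rightarrow> 'x) \<Rightarrow> bool" where
  "continuous_action G X act \<longleftrightarrow>
     group_action G X act \<and> (\<forall>g\<in>carrier G. continuous_on X (act g))"

primrec cantor_stage :: "nat \<Rightarrow> real set" where
  "cantor_stage 0 = {0..1}"
| "cantor_stage (Suc n) =
     (\<lambda>x. x / 3) ` cantor_stage n \<union> (\<lambda>x. 2 / 3 + x / 3) ` cantor_stage n"

definition standard_cantor_set :: "real set" where
  "standard_cantor_set = (\<Inter>n. cantor_stage n)"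

definition is_cantor_set :: "'x::topological_space set \<Rightarrow> bool" where
  "is_cantor_set K \<longleftrightarrow> K homeomorphic standard_cantor_set"

end

theory Submission
  imports Defs "HOL-Library.Diagonal_Subsequence"
begin

text \<open>
Sofic models of a system with positive entropy are plentiful: for some scale \<open>e\<close> and rate \<open>c\<close>,
every precision, however fine, admits at least \<open>exp (c n)\<close> approximately equivariant maps
\<open>\<phi> : {1..n} \<rightarrow> X\<close> that are pairwise \<open>e\<close>-apart at some vertex (\<open>rich_models_of_entropy\<close>).
A system of that size still has exponential size after any datum of small exponential growth has
been fixed by the pigeonhole principle.  Three such data are fixed at once: the small set of
vertices at which \<open>\<phi>\<close> fails to be equivariant; the approximate value of \<open>\<phi>\<close> on very sparse
sets \<open>R k\<close> of vertices, at precision tending to 0 with \<open>k\<close>; and the small set of vertices at which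
the distance of \<open>\<phi>\<close> to some net point falls into a forbidden band.  What remains are
binary patterns, and the Sauer-Shelah lemma yields a set \<open>J\<close> of vertices, of density at least
some \<open>q > 0\<close> that depends only on \<open>e\<close>, \<open>c\<close> and \<open>X\<close>, on which the maps \<open>\<phi>\<close> realize every function from \<open>J\<close>
into two sets at distance at least \<open>\<gamma>\<close> (\<open>separated_models_independent\<close>).

Now fix one vertex \<open>v\<close> and move it by the permutations \<open>\<alpha> i\<close> that model \<open>s i\<close>.  Approximate equivariance
identifies \<open>s i \<phi>(v)\<close> with \<open>\<phi>(\<alpha> i v)\<close>.  At the times \<open>i\<close> when \<open>\<alpha> i v\<close> lies in \<open>J\<close>, the points \<open>\<phi>(v)\<close> can be
sent independently to either of the two separated sets; at the times when \<open>\<alpha> i v\<close> lies in \<open>R k\<close>, all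
of them are sent close to one and the same point.  That distinct elements move most vertices to
distinct places makes the choices at different times independent.
Both kinds of times occur often.  For the sparse sets \<open>R k\<close> this is a matter of choice: a
set of tiny density that meets the orbit of most vertices within a long window of times
exists by \<open>small_hitting_set\<close>.  For \<open>J\<close> it is a form of Fatou's lemma: sets of measure at least
\<open>q\<close> have an upper limit of measure at least \<open>q\<close> (\<open>recurrent_windows\<close>).

Letting the precision tend to 0 and using compactness one obtains times \<open>a k\<close> and \<open>b k\<close> such that
every 0-1-sequence is realized by a point of \<open>X\<close> at the times \<open>a k\<close>, while all these points come
together at the times \<open>b k\<close> (\<open>free_and_proximal_times\<close>).  Repeating every digit of the sequence
infinitely often makes different sequences differ at infinitely many times.  The points so
obtained form a compact set that is mapped continuously onto the space of 0-1-sequences, and such a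
set contains a Cantor set on which the map is injective (\<open>cantor_set_of_codes\<close>).
\<close>

section \<open>Counting and shattering\<close>

text \<open>
The binomial tail bound at its crudest: weigh every subset \<open>Y\<close> by \<open>x ^ card Y\<close>.  The total weight is
\<open>(1 + x) ^ card Z\<close>, and a subset of small relative size has weight at least \<open>exp (- (b / 2) * card Z)\<close>.
\<close>
lemma card_small_subsets:
  fixes b :: real
  assumes "b > 0"
  shows "\<exists>\<kappa>>0. \<forall>Z :: 'z set. finite Z \<longrightarrow>
    real (card {Y. Y \<subseteq> Z \<and> real (card Y) \<le> \<kappa> * real (card Z)}) \<le> exp (b * real (card Z))"
proof -
  define x where "x = min 1 (b / 2)"
  have x: "0 < x" "x \<le> 1" "x \<le> b / 2" using assms by (auto simp: x_def)
  define \<kappa> where "\<kappa> = (b / 2) / (1 + ln (1 / x))"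
  have l: "ln (1 / x) \<ge> 0" using x by simp
  have k: "\<kappa> > 0" using l assms by (simp add: \<kappa>_def)
  have "(b / 2) * ln (1 / x) \<le> (b / 2) * (1 + ln (1 / x))" using assms by simp
  then have kl: "\<kappa> * ln (1 / x) \<le> b / 2"
    using l by (simp add: \<kappa>_def pos_divide_le_eq algebra_simps)
  have "real (card {Y. Y \<subseteq> Z \<and> real (card Y) \<le> \<kappa> * real (card Z)}) \<le> exp (b * real (card Z))"
    if Z: "finite Z" for Z :: "'z set"
  proof -
    let ?S = "{Y. Y \<subseteq> Z \<and> real (card Y) \<le> \<kappa> * real (card Z)}"
    have le: "exp (- (b / 2) * real (card Z)) \<le> x ^ card Y" if "Y \<in> ?S" for Y
    proof -
      have "real (card Y) * ln (1 / x) \<le> \<kappa> * real (card Z) * ln (1 / x)"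
        using that l by (intro mult_right_mono) auto
      also have "\<dots> = \<kappa> * ln (1 / x) * real (card Z)" by simp
      also have "\<dots> \<le> b / 2 * real (card Z)" using kl by (intro mult_right_mono) auto
      finally have "- (b / 2) * real (card Z) \<le> real (card Y) * ln x"
        using x by (simp add: ln_div)
      then have "exp (- (b / 2) * real (card Z)) \<le> exp (real (card Y) * ln x)" by simp
      also have "\<dots> = x ^ card Y" using x by (simp add: exp_of_nat_mult)
      finally show ?thesis .
    qed
    have "real (card ?S) * exp (- (b / 2) * real (card Z)) \<le> (\<Sum>Y\<in>?S. x ^ card Y)"
      using sum_bounded_below[of ?S "exp (- (b / 2) * real (card Z))" "\<lambda>Y. x ^ card Y"] le by simp
    also have "\<dots> \<le> (\<Sum>Y\<in>Pow Z. x ^ card Y)"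
      using Z x by (intro sum_mono2) auto
    also have "\<dots> = (\<Prod>z\<in>Z. x + 1)"
      using prod_add[OF Z, of "\<lambda>_. x" "\<lambda>_. 1"] by simp
    also have "\<dots> = (1 + x) ^ card Z" by (simp add: add.commute)
    also have "\<dots> \<le> exp x ^ card Z" using x by (intro power_mono exp_ge_add_one_self) auto
    also have "\<dots> = exp (real (card Z) * x)" by (simp add: exp_of_nat_mult)
    also have "\<dots> \<le> exp (real (card Z) * (b / 2))"
      unfolding exp_le_cancel_iff using x by (intro mult_left_mono) auto
    also have "\<dots> = exp (b / 2 * real (card Z))" by (simp add: mult.commute)
    finally have "real (card ?S) * exp (- (b / 2) * real (card Z)) * exp (b / 2 * real (card Z))
        \<le> exp (b / 2 * real (card Z)) * exp (b / 2 * real (card Z))" by simp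
    then show ?thesis by (simp add: mult.assoc flip: exp_add)
  qed
  with k show ?thesis by blast
qed

lemma pigeonhole_fibre:
  fixes a b :: real
  assumes "finite S" "finite T" "D ` S \<subseteq> T" "real (card T) \<le> b" "a * b \<le> real (card S)" "a > 0" "S \<noteq> {}"
  shows "\<exists>t\<in>T. a \<le> real (card {\<phi>\<in>S. D \<phi> = t})"
proof (rule ccontr)
  assume "\<not> ?thesis"
  then have lt: "\<And>t. t \<in> T \<Longrightarrow> real (card {\<phi>\<in>S. D \<phi> = t}) < a" by force
  have ne: "T \<noteq> {}" using assms by auto
  have "real (card S) = (\<Sum>t\<in>T. real (card {\<phi>\<in>S. D \<phi> = t}))"
    using sum.group[OF assms(1-3), of "\<lambda>_. 1::nat"] by (simp flip: of_nat_sum)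
  also have "\<dots> < (\<Sum>t\<in>T. a)" using lt assms(2) ne by (intro sum_strict_mono) auto
  also have "\<dots> = a * real (card T)" by simp
  also have "\<dots> \<le> a * b" using assms by (intro mult_left_mono) auto
  finally show False using assms by simp
qed

definition shatters :: "'z set set \<Rightarrow> 'z set \<Rightarrow> bool" where
  "shatters \<F> T \<longleftrightarrow> (\<forall>U\<subseteq>T. \<exists>A\<in>\<F>. A \<inter> T = U)"

text \<open>
Pajor's form of the Sauer-Shelah lemma, which allows an induction over the ground set: split
the family by membership of a new point \<open>z\<close>.  A set shattered by one of the halves
is shattered by the family, and a set \<open>T\<close> shattered by both halves contributes \<open>insert z T\<close> as well.
\<close>
lemma card_le_card_shattered:
  fixes Z :: "'z set"
  assumes "finite Z" "\<F> \<subseteq> Pow Z"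
  shows "card \<F> \<le> card {T. T \<subseteq> Z \<and> shatters \<F> T}"
  using assms
proof (induction Z arbitrary: \<F> rule: finite_induct)
  case empty
  show ?case
  proof (cases "\<F> = {}")
    case False
    with empty have F: "\<F> = {{}}" by auto
    then have "{T. T \<subseteq> {} \<and> shatters \<F> T} = {{}}" by (auto simp: shatters_def)
    then have "card {T. T \<subseteq> {} \<and> shatters \<F> T} = card {{} :: 'z set}" by (rule arg_cong)
    then show ?thesis unfolding F by simp
  qed simp
next
  case (insert z Z)
  define F0 where "F0 = {A \<in> \<F>. z \<notin> A}"
  define F1 where "F1 = (\<lambda>A. A - {z}) ` {A \<in> \<F>. z \<in> A}"
  let ?sh = "\<lambda>G. {T. T \<subseteq> Z \<and> shatters G T}"
  have fin: "finite \<F>" using insert.prems insert.hyps by (simp add: finite_subset)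
  have P: "F0 \<subseteq> Pow Z" "F1 \<subseteq> Pow Z" using insert.prems by (auto simp: F0_def F1_def)
  have c1: "card F1 = card {A \<in> \<F>. z \<in> A}"
    unfolding F1_def by (intro card_image inj_onI) blast
  have "\<F> = F0 \<union> {A \<in> \<F>. z \<in> A}" by (auto simp: F0_def)
  then have "card \<F> = card F0 + card {A \<in> \<F>. z \<in> A}"
    using fin by (subst card_Un_disjoint[symmetric]) (auto simp: F0_def)
  then have "card \<F> = card F0 + card F1" using c1 by simp
  also have "\<dots> \<le> card (?sh F0) + card (?sh F1)"
    using insert.IH[OF P(1)] insert.IH[OF P(2)] by (rule add_mono)
  also have "\<dots> = card (?sh F0 \<union> ?sh F1) + card (?sh F0 \<inter> ?sh F1)"
    using insert.hyps by (intro card_Un_Int) auto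
  also have "card (?sh F0 \<inter> ?sh F1) = card (insert z ` (?sh F0 \<inter> ?sh F1))"
  proof (intro card_image[symmetric] inj_onI)
    fix S T assume "S \<in> ?sh F0 \<inter> ?sh F1" "T \<in> ?sh F0 \<inter> ?sh F1" and eq: "insert z S = insert z T"
    then have "z \<notin> S" "z \<notin> T" using insert.hyps by auto
    with eq show "S = T" by (simp add: insert_ident)
  qed
  also have "card (?sh F0 \<union> ?sh F1) + card (insert z ` (?sh F0 \<inter> ?sh F1))
      = card ((?sh F0 \<union> ?sh F1) \<union> insert z ` (?sh F0 \<inter> ?sh F1))"
    using insert.hyps by (intro card_Un_disjoint[symmetric]) auto
  also have "\<dots> \<le> card {T. T \<subseteq> insert z Z \<and> shatters \<F> T}"
  proof (rule card_mono)
    show "finite {T. T \<subseteq> insert z Z \<and> shatters \<F> T}" using insert.hyps by auto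
    have s0: "shatters \<F> T" if "shatters F0 T" for T
      using that by (auto simp: shatters_def F0_def)
    have s1: "shatters \<F> T" if "shatters F1 T" "T \<subseteq> Z" for T
      unfolding shatters_def
    proof (intro allI impI)
      fix U assume "U \<subseteq> T"
      with that(1) obtain B where "B \<in> F1" "B \<inter> T = U"
        unfolding shatters_def by blast
      then obtain A where A: "A \<in> \<F>" "(A - {z}) \<inter> T = U" "z \<in> A"
        unfolding F1_def by blast
      then have "A \<inter> T = U" using insert.hyps that by auto
      with A show "\<exists>A\<in>\<F>. A \<inter> T = U" by blast
    qed
    have s2: "shatters \<F> (insert z T)" if "shatters F0 T" "shatters F1 T" "T \<subseteq> Z" for T
      unfolding shatters_def
    proof (intro allI impI)
      fix U assume U: "U \<subseteq> insert z T"
      show "\<exists>A\<in>\<F>. A \<inter> insert z T = U"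
      proof (cases "z \<in> U")
        case True
        from U have "U - {z} \<subseteq> T" by auto
        with that(2) obtain B where "B \<in> F1" "B \<inter> T = U - {z}"
          unfolding shatters_def by blast
        then obtain A where A: "A \<in> \<F>" "(A - {z}) \<inter> T = U - {z}" "z \<in> A"
          unfolding F1_def by blast
        then have "A \<inter> insert z T = U" using True U insert.hyps that by auto
        with A show ?thesis by blast
      next
        case False
        with U have "U \<subseteq> T" by auto
        with that obtain A where A: "A \<in> \<F>" "A \<inter> T = U" "z \<notin> A"
          unfolding shatters_def F0_def by blast
        then have "A \<inter> insert z T = U" by auto
        with A show ?thesis by blast
      qed
    qed
    show "?sh F0 \<union> ?sh F1 \<union> insert z ` (?sh F0 \<inter> ?sh F1) \<subseteq> {T. T \<subseteq> insert z Z \<and> shatters \<F> T}"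
    proof (intro Un_least subsetI CollectI)
      fix T assume "T \<in> ?sh F0"
      then show "T \<subseteq> insert z Z \<and> shatters \<F> T" using s0 by blast
    next
      fix T assume "T \<in> ?sh F1"
      then show "T \<subseteq> insert z Z \<and> shatters \<F> T" using s1 by blast
    next
      fix T assume "T \<in> insert z ` (?sh F0 \<inter> ?sh F1)"
      then obtain T' where "T = insert z T'" "T' \<subseteq> Z" "shatters F0 T'" "shatters F1 T'" by blast
      then show "T \<subseteq> insert z Z \<and> shatters \<F> T" using s2[of T'] by blast
    qed
  qed
  finally show ?case .
qed

text \<open>
There are too few small sets to account for all the shattered ones.
\<close>
lemma dense_shattered:
  fixes b :: real
  assumes "b > 0"
  shows "\<exists>\<kappa>>0. \<forall>(Z :: 'z set) \<F>. finite Z \<and> \<F> \<subseteq> Pow Z \<and> exp (b * real (card Z)) < real (card \<F>) \<longrightarrow>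
    (\<exists>T\<subseteq>Z. shatters \<F> T \<and> \<kappa> * real (card Z) < real (card T))"
proof -
  obtain \<kappa> where k: "\<kappa> > 0" and K: "\<And>Z :: 'z set. finite Z \<Longrightarrow>
     real (card {Y. Y \<subseteq> Z \<and> real (card Y) \<le> \<kappa> * real (card Z)}) \<le> exp (b * real (card Z))"
    using card_small_subsets[OF assms, where 'z='z] by blast
  have "\<exists>T\<subseteq>Z. shatters \<F> T \<and> \<kappa> * real (card Z) < real (card T)"
    if A: "finite Z" "\<F> \<subseteq> Pow Z" "exp (b * real (card Z)) < real (card \<F>)" for Z :: "'z set" and \<F>
  proof (rule ccontr)
    assume "\<not> ?thesis"
    then have "real (card T) \<le> \<kappa> * real (card Z)" if "T \<subseteq> Z" "shatters \<F> T" for T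
      using that not_less by blast
    then have "{T. T \<subseteq> Z \<and> shatters \<F> T} \<subseteq> {Y. Y \<subseteq> Z \<and> real (card Y) \<le> \<kappa> * real (card Z)}"
      by blast
    then have "card {T. T \<subseteq> Z \<and> shatters \<F> T} \<le> card {Y. Y \<subseteq> Z \<and> real (card Y) \<le> \<kappa> * real (card Z)}"
      using A by (intro card_mono) auto
    with card_le_card_shattered[OF A(1,2)] K[OF A(1)] A(3) show False by linarith
  qed
  with k show ?thesis by blast
qed

text \<open>
The set \<open>R\<close> maximizes the number of sets \<open>E v\<close> that it meets minus a price of \<open>\<tau> M\<close> per point.
Comparison with the empty set bounds the size of \<open>R\<close>.  Since no further point is worth its price, each point
lies in at most \<open>\<tau> M\<close> of the missed sets; as these have at least \<open>M\<close> elements each, double counting bounds their number.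
\<close>
lemma small_hitting_set:
  fixes \<tau> :: real
  assumes fin: "finite V" "finite U" and E: "\<And>v. v \<in> V \<Longrightarrow> E v \<subseteq> U"
    and M: "\<And>v. v \<in> V \<Longrightarrow> M \<le> card (E v)" and "\<tau> > 0" "M > 0"
  shows "\<exists>R\<subseteq>U. real (card R) * (\<tau> * M) \<le> real (card V) \<and>
     real (card {v\<in>V. E v \<inter> R = {}}) \<le> \<tau> * real (card U)"
proof -
  define val where "val R = real (card {v\<in>V. E v \<inter> R \<noteq> {}}) - \<tau> * M * card R" for R
  have "Max (val ` Pow U) \<in> val ` Pow U" using fin by (intro Max_in) auto
  then obtain R where R: "R \<subseteq> U" "Max (val ` Pow U) = val R" by auto
  have max: "val R' \<le> val R" if "R' \<subseteq> U" for R'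
    unfolding R(2)[symmetric] using that fin by (intro Max_ge) auto
  have "val {} \<le> val R" using max by simp
  moreover have "card {v\<in>V. E v \<inter> R \<noteq> {}} \<le> card V" using fin by (intro card_mono) auto
  ultimately have 1: "real (card R) * (\<tau> * M) \<le> real (card V)" by (simp add: val_def algebra_simps)
  define W where "W = {v\<in>V. E v \<inter> R = {}}"
  have deg: "real (card {v\<in>W. u \<in> E v}) \<le> \<tau> * M" if u: "u \<in> U" for u
  proof (cases "u \<in> R")
    case True
    then have "{v\<in>W. u \<in> E v} = {}" by (auto simp: W_def)
    then have "card {v\<in>W. u \<in> E v} = 0" by (simp only: card.empty)
    moreover have "0 \<le> \<tau> * M" using \<open>\<tau> > 0\<close> by simp
    ultimately show ?thesis by simp
  next
    case False
    define H where "H = {v\<in>V. E v \<inter> R \<noteq> {}}"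
    have "{v\<in>V. E v \<inter> insert u R \<noteq> {}} = H \<union> {v\<in>W. u \<in> E v}"
      by (auto simp: W_def H_def)
    moreover have "card (H \<union> {v\<in>W. u \<in> E v}) = card H + card {v\<in>W. u \<in> E v}"
      using fin by (intro card_Un_disjoint) (auto simp: W_def H_def)
    moreover have "card (insert u R) = Suc (card R)"
      using False fin R(1) by (simp add: finite_subset)
    ultimately have "val (insert u R) = real (card H) + real (card {v\<in>W. u \<in> E v}) - \<tau> * M * (1 + real (card R))"
      unfolding val_def by (simp only: of_nat_add of_nat_Suc)
    moreover have "val R = real (card H) - \<tau> * M * real (card R)" by (simp only: val_def H_def)
    moreover have "val (insert u R) \<le> val R" using max u R(1) by blast
    ultimately show ?thesis by (simp only: distrib_left mult_1_right)
  qed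
  have finW: "finite W" using fin by (simp add: W_def)
  have "card W * M \<le> (\<Sum>v\<in>W. card (E v))"
    using sum_bounded_below[of W M "\<lambda>v. card (E v)"] M unfolding W_def by simp
  also have "\<dots> = (\<Sum>v\<in>W. card {u\<in>U. u \<in> E v})"
  proof (rule sum.cong[OF refl])
    fix v assume "v \<in> W"
    then have "E v \<subseteq> U" using E unfolding W_def by blast
    then have "E v = {u\<in>U. u \<in> E v}" by blast
    then show "card (E v) = card {u\<in>U. u \<in> E v}" by (rule arg_cong)
  qed
  also have "\<dots> = (\<Sum>u\<in>U. card {v\<in>W. u \<in> E v})"
    unfolding card_eq_sum by (rule sum.swap_restrict[OF finW fin(2)])
  finally have "real (card W * M) \<le> real (\<Sum>u\<in>U. card {v\<in>W. u \<in> E v})"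
    by (simp only: of_nat_le_iff)
  then have "real (card W) * M \<le> (\<Sum>u\<in>U. real (card {v\<in>W. u \<in> E v}))" by simp
  also have "\<dots> \<le> (\<Sum>u\<in>U. \<tau> * M)" using deg by (intro sum_mono) auto
  finally have "real (card W) * M \<le> (\<tau> * card U) * M" by (simp add: algebra_simps)
  then have "real (card W) \<le> \<tau> * card U" using \<open>M > 0\<close> by (simp only: mult_le_cancel_right_pos of_nat_0_less_iff)
  with 1 R(1) show ?thesis unfolding W_def by blast
qed

section \<open>Independence sets for separated models\<close>

text \<open>
Measure the distance to the net points \<open>p \<in> P\<close>.  Two points at distance at least \<open>e\<close> are told apart by the net
point nearest to one of them: one distance is below \<open>e / 4\<close>, the other at least \<open>3 e / 4\<close>.  The interval between these
bounds is cut into \<open>L\<close> disjoint open bands of width \<open>\<gamma>\<close>, so that for each map some band contains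
few of the distances.  Once the band and the set of pairs \<open>(p, v)\<close> whose distance falls into it are fixed,
which costs a factor of small exponential growth, a map is determined by the set of pairs with distance below the band,
and two maps that differ do so at a pair outside the band.  Hence the Sauer-Shelah lemma
applies to honest binary patterns.  A shattered set of pairs
is dense over one of the net points.
\<close>
lemma separated_models_independent:
  fixes X :: "'x::metric_space set" and e c :: real
  assumes e: "e > 0" and c: "c > 0" and P: "finite P" "X \<subseteq> (\<Union>p\<in>P. ball p (e/4))"
  shows "\<exists>\<gamma>>0. \<exists>q>0. \<exists>Q n0. finite Q \<and> (\<forall>n\<ge>n0. \<forall>S :: (nat \<Rightarrow> 'x) set.
    finite S \<and> (\<forall>\<phi>\<in>S. \<phi> ` {1..n} \<subseteq> X) \<and> exp (c * real n) \<le> real (card S) \<and>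
    (\<forall>\<phi>\<in>S. \<forall>\<psi>\<in>S. \<phi> \<noteq> \<psi> \<longrightarrow> (\<exists>v\<in>{1..n}. e \<le> dist (\<phi> v) (\<psi> v))) \<longrightarrow>
    (\<exists>p\<in>P. \<exists>t\<in>Q. \<exists>J\<subseteq>{1..n}. q * real n \<le> real (card J) \<and>
      (\<forall>U\<subseteq>J. \<exists>\<phi>\<in>S. (\<forall>v\<in>U. dist (\<phi> v) p \<le> t) \<and> (\<forall>v\<in>J - U. t + \<gamma> \<le> dist (\<phi> v) p))))"
proof -
  define r where "r = real (card P)"
  define b where "b = c / (4 * (r + 1))"
  have r0: "0 \<le> r" by (simp add: r_def)
  have b: "b > 0" "b * r \<le> c / 4"
    using c r0 by (auto simp: b_def field_simps)
  obtain \<kappa>1 where k1: "\<kappa>1 > 0" and K1: "\<And>Z :: ('x \<times> nat) set. finite Z \<Longrightarrow>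
     real (card {Y. Y \<subseteq> Z \<and> real (card Y) \<le> \<kappa>1 * real (card Z)}) \<le> exp (b * real (card Z))"
    using card_small_subsets[OF b(1), where 'z="'x \<times> nat"] by blast
  obtain \<kappa>2 where k2: "\<kappa>2 > 0" and K2: "\<forall>(Z :: ('x \<times> nat) set) \<F>.
      finite Z \<and> \<F> \<subseteq> Pow Z \<and> exp (b * real (card Z)) < real (card \<F>) \<longrightarrow>
      (\<exists>T\<subseteq>Z. shatters \<F> T \<and> \<kappa>2 * real (card Z) < real (card T))"
    using dense_shattered[OF b(1), where 'z="'x \<times> nat"] by (elim exE conjE)
  obtain L :: nat where L: "L > 0" "1 / real L < \<kappa>1"
    using k1 by (metis nat_approx_posE zero_less_Suc)
  define \<gamma> where "\<gamma> = e / (2 * real L)"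
  have g: "\<gamma> > 0" using e L by (simp add: \<gamma>_def)
  have gL: "\<gamma> * real L = e / 2" using L by (simp add: \<gamma>_def)
  define t where "t l = e / 4 + real l * \<gamma>" for l
  obtain n0 :: nat where n0: "4 * ln (real L) / c < real n0" using reals_Archimedean2 by blast
  have main: "\<exists>p\<in>P. \<exists>t\<in>t ` {..<L}. \<exists>J\<subseteq>{1..n}. \<kappa>2 * real n \<le> real (card J) \<and>
      (\<forall>U\<subseteq>J. \<exists>\<phi>\<in>S. (\<forall>v\<in>U. dist (\<phi> v) p \<le> t) \<and> (\<forall>v\<in>J - U. t + \<gamma> \<le> dist (\<phi> v) p))"
    if n: "n \<ge> Suc n0" and S: "finite S" and SX: "\<And>\<phi>. \<phi> \<in> S \<Longrightarrow> \<phi> ` {1..n} \<subseteq> X"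
      and big: "exp (c * real n) \<le> real (card S)"
      and sep: "\<And>\<phi> \<psi>. \<phi> \<in> S \<Longrightarrow> \<psi> \<in> S \<Longrightarrow> \<phi> \<noteq> \<psi> \<Longrightarrow> (\<exists>v\<in>{1..n}. e \<le> dist (\<phi> v) (\<psi> v))"
    for n and S :: "(nat \<Rightarrow> 'x) set"
  proof -
    define Z where "Z = P \<times> {1..n}"
    have Z: "finite Z" "real (card Z) = r * real n" using P by (auto simp: Z_def r_def card_cartesian_product)
    have "real (card S) > 0" using big by (meson exp_gt_zero less_le_trans)
    then have S0: "S \<noteq> {}" by auto
    have bZ: "b * real (card Z) \<le> c * real n / 4"
      using mult_right_mono[OF b(2), of "real n"] by (simp add: Z mult.assoc)
    have Lexp: "real L \<le> exp (c * real n / 4)"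
    proof -
      have "4 * ln (real L) / c < real n" using n0 n by linarith
      then have "ln (real L) < c * real n / 4" using c by (simp add: field_simps)
      then have "exp (ln (real L)) \<le> exp (c * real n / 4)" by simp
      then show ?thesis using L by simp
    qed
    define star where "star \<phi> l = {(p, v). (p, v) \<in> Z \<and> t l < dist (\<phi> v) p \<and> dist (\<phi> v) p < t l + \<gamma>}"
      for \<phi> :: "nat \<Rightarrow> 'x" and l
    have starZ: "star \<phi> l \<subseteq> Z" for \<phi> l by (auto simp: star_def)
    have tmono: "t l + \<gamma> \<le> t m" if "l < m" for l m
    proof -
      have "real (Suc l) * \<gamma> \<le> real m * \<gamma>" using that g by (intro mult_right_mono) auto
      then show ?thesis by (simp add: t_def algebra_simps)
    qed
    have disj: "star \<phi> l \<inter> star \<phi> m = {}" if "l < m" for \<phi> l m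
      using tmono[OF that] by (force simp: star_def)
    have disj': "star \<phi> l \<inter> star \<phi> m = {}" if "l \<noteq> m" for \<phi> l m
      using disj[of l m \<phi>] disj[of m l \<phi>] that by (metis Int_commute linorder_neqE_nat)
    have "\<exists>l<L. real (card (star \<phi> l)) \<le> \<kappa>1 * real (card Z)" for \<phi>
    proof (rule ccontr)
      assume "\<not> ?thesis"
      then have gt: "\<kappa>1 * real (card Z) < real (card (star \<phi> l))" if "l < L" for l using that by (meson not_le)
      have "real L * (\<kappa>1 * real (card Z)) = (\<Sum>l<L. \<kappa>1 * real (card Z))" by simp
      also have "\<dots> < (\<Sum>l<L. real (card (star \<phi> l)))"
        using gt L by (intro sum_strict_mono) auto
      also have "\<dots> = real (card (\<Union>l<L. star \<phi> l))"
      proof (subst card_UN_disjoint)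
        show "\<forall>i\<in>{..<L}. finite (star \<phi> i)" using finite_subset[OF starZ Z(1)] by blast
        show "\<forall>i\<in>{..<L}. \<forall>j\<in>{..<L}. i \<noteq> j \<longrightarrow> star \<phi> i \<inter> star \<phi> j = {}" using disj' by blast
      qed simp_all
      also have "\<dots> \<le> real (card Z)" using starZ Z(1) by (intro of_nat_mono card_mono) blast+
      finally have "real L * \<kappa>1 * real (card Z) < 1 * real (card Z)" by simp
      then have "real L * \<kappa>1 < 1" by (rule mult_right_less_imp_less) simp
      with L show False by (simp add: field_simps)
    qed
    then obtain lf where lf: "\<And>\<phi>. lf \<phi> < L" "\<And>\<phi>. real (card (star \<phi> (lf \<phi>))) \<le> \<kappa>1 * real (card Z)" by metis
    let ?T = "{..<L} \<times> {Y. Y \<subseteq> Z \<and> real (card Y) \<le> \<kappa>1 * real (card Z)}"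
    have "\<exists>y\<in>?T. exp (c * real n / 2) \<le> real (card {\<phi>\<in>S. (lf \<phi>, star \<phi> (lf \<phi>)) = y})"
    proof (rule pigeonhole_fibre[where b="exp (c * real n / 2)"])
      show "finite ?T" using Z by auto
      show "(\<lambda>\<phi>. (lf \<phi>, star \<phi> (lf \<phi>))) ` S \<subseteq> ?T"
      proof (rule image_subsetI)
        fix \<phi> show "(lf \<phi>, star \<phi> (lf \<phi>)) \<in> ?T" using lf[of \<phi>] starZ[of \<phi>] by simp
      qed
      have "real (card ?T) = real L * real (card {Y. Y \<subseteq> Z \<and> real (card Y) \<le> \<kappa>1 * real (card Z)})"
        by (simp add: card_cartesian_product)
      also have "\<dots> \<le> exp (c * real n / 4) * exp (b * real (card Z))"
        using Lexp K1[OF Z(1)] by (intro mult_mono) auto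
      also have "\<dots> \<le> exp (c * real n / 4) * exp (c * real n / 4)" using bZ by simp
      also have "\<dots> = exp (c * real n / 2)" by (simp flip: exp_add)
      finally show "real (card ?T) \<le> exp (c * real n / 2)" .
      show "exp (c * real n / 2) * exp (c * real n / 2) \<le> real (card S)" using big by (simp flip: exp_add)
    qed (use S S0 in auto)
    then obtain l Y where lY: "l < L" "Y \<subseteq> Z"
      and big': "exp (c * real n / 2) \<le> real (card {\<phi>\<in>S. (lf \<phi>, star \<phi> (lf \<phi>)) = (l, Y)})" by blast
    define S' where "S' = {\<phi>\<in>S. (lf \<phi>, star \<phi> (lf \<phi>)) = (l, Y)}"
    have S': "S' \<subseteq> S" "finite S'" and Y: "\<And>\<phi>. \<phi> \<in> S' \<Longrightarrow> star \<phi> l = Y" using S by (auto simp: S'_def)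
    define pat where "pat \<phi> = {(p, v). (p, v) \<in> Z - Y \<and> dist (\<phi> v) p \<le> t l}" for \<phi> :: "nat \<Rightarrow> 'x"
    have tl: "e / 4 \<le> t l" "t l + \<gamma> \<le> 3 * e / 4"
    proof -
      show "e / 4 \<le> t l" using g by (simp add: t_def)
      have "real (Suc l) * \<gamma> \<le> real L * \<gamma>" using lY g by (intro mult_right_mono) auto
      then show "t l + \<gamma> \<le> 3 * e / 4" using gL by (simp add: t_def algebra_simps)
    qed
    \<comment> \<open>Both maps have the same star pairs, and the pair at which they differ is not one of these.\<close>
    have inj: "inj_on pat S'"
    proof (rule inj_onI, rule ccontr)
      fix \<phi> \<psi> assume in': "\<phi> \<in> S'" "\<psi> \<in> S'" and eq: "pat \<phi> = pat \<psi>" and ne: "\<phi> \<noteq> \<psi>"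
      then obtain v where v: "v \<in> {1..n}" "e \<le> dist (\<phi> v) (\<psi> v)" using sep S'(1) by blast
      have "\<phi> v \<in> X" using SX[of \<phi>] in' S'(1) v(1) by blast
      then obtain p where p: "p \<in> P" "dist p (\<phi> v) < e / 4" using P by auto
      have "(p, v) \<in> Z" using p v by (simp add: Z_def)
      moreover have "(p, v) \<notin> Y"
        using Y[OF in'(1)] p(2) tl(1) by (auto simp: star_def dist_commute)
      ultimately have "(p, v) \<in> pat \<phi>" using p(2) tl(1) by (auto simp: pat_def dist_commute)
      with eq have "(p, v) \<in> pat \<psi>" by simp
      then have "dist (\<psi> v) p \<le> t l" by (simp add: pat_def)
      with v(2) p(2) tl g dist_triangle[of "\<phi> v" "\<psi> v" p] show False by (simp add: dist_commute)
    qed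
    have "card (pat ` S') = card S'" using inj by (rule card_image)
    moreover have "exp (b * real (card Z)) < exp (c * real n / 2)"
    proof -
      have "c * real n / 4 < c * real n / 2" using c n by simp
      with bZ show ?thesis unfolding exp_less_cancel_iff by linarith
    qed
    ultimately have "exp (b * real (card Z)) < real (card (pat ` S'))"
      using big' unfolding S'_def[symmetric] by linarith
    moreover have "pat ` S' \<subseteq> Pow Z" by (auto simp: pat_def)
    ultimately obtain T where T: "T \<subseteq> Z" "shatters (pat ` S') T" "\<kappa>2 * real (card Z) < real (card T)"
      using K2[rule_format, of Z "pat ` S'"] Z(1) by blast
    \<comment> \<open>A shattered set is contained in a member of the family, so it avoids the star pairs.\<close>
    obtain A where "A \<in> pat ` S'" "A \<inter> T = T" using T(2) unfolding shatters_def by blast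
    then have TY: "T \<inter> Y = {}" by (auto simp: pat_def)
    define Jp where "Jp p = {v. (p, v) \<in> T}" for p
    have Jp: "Jp p \<subseteq> {1..n}" for p using T(1) by (auto simp: Jp_def Z_def)
    then have finJ: "finite (Jp p)" for p by (meson finite_atLeastAtMost finite_subset)
    have "\<exists>p\<in>P. \<kappa>2 * real n \<le> real (card (Jp p))"
    proof (rule ccontr)
      assume "\<not> ?thesis"
      then have lt: "real (card (Jp p)) \<le> \<kappa>2 * real n" if "p \<in> P" for p using that by (meson le_cases)
      have "T = Sigma P Jp" using T(1) by (auto simp: Jp_def Z_def)
      then have "real (card T) = (\<Sum>p\<in>P. real (card (Jp p)))"
        using P finJ by (simp add: card_SigmaI)
      also have "\<dots> \<le> (\<Sum>p\<in>P. \<kappa>2 * real n)" using lt by (intro sum_mono)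
      also have "\<dots> = \<kappa>2 * real (card Z)" by (simp add: Z(2) r_def)
      finally show False using T(3) by simp
    qed
    then obtain p where p: "p \<in> P" "\<kappa>2 * real n \<le> real (card (Jp p))" by blast
    have "\<exists>\<phi>\<in>S. (\<forall>v\<in>U. dist (\<phi> v) p \<le> t l) \<and> (\<forall>v\<in>Jp p - U. t l + \<gamma> \<le> dist (\<phi> v) p)"
      if U: "U \<subseteq> Jp p" for U
    proof -
      have "{p} \<times> U \<subseteq> T" using U by (auto simp: Jp_def)
      then obtain \<phi> where phi: "\<phi> \<in> S'" "pat \<phi> \<inter> T = {p} \<times> U"
        using T(2) unfolding shatters_def by blast
      have "dist (\<phi> v) p \<le> t l" if "v \<in> U" for v
      proof -
        have "(p, v) \<in> pat \<phi>" using phi(2) that by blast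
        then show ?thesis by (simp add: pat_def)
      qed
      moreover have "t l + \<gamma> \<le> dist (\<phi> v) p" if v: "v \<in> Jp p - U" for v
      proof -
        have "(p, v) \<in> T" "(p, v) \<notin> pat \<phi>" using phi(2) v by (auto simp: Jp_def)
        moreover from this have "(p, v) \<in> Z - Y" using T(1) TY by blast
        ultimately have "t l < dist (\<phi> v) p" "(p, v) \<notin> star \<phi> l" "(p, v) \<in> Z"
          using Y[OF phi(1)] by (auto simp: pat_def)
        then show ?thesis by (simp add: star_def)
      qed
      ultimately show ?thesis using phi(1) S'(1) by blast
    qed
    then show ?thesis using p lY(1) Jp by blast
  qed
  show ?thesis
  proof (intro exI conjI allI impI)
    show "\<gamma> > 0" "\<kappa>2 > 0" "finite (t ` {..<L})" using g k2 by auto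
    fix n S assume "n \<ge> Suc n0" "finite S \<and> (\<forall>\<phi>\<in>S. \<phi> ` {1..n} \<subseteq> X) \<and> exp (c * real n) \<le> real (card S) \<and>
      (\<forall>\<phi>\<in>S. \<forall>\<psi>\<in>S. \<phi> \<noteq> \<psi> \<longrightarrow> (\<exists>v\<in>{1..n}. e \<le> dist (\<phi> v) (\<psi> v)))"
    then show "\<exists>p\<in>P. \<exists>t\<in>t ` {..<L}. \<exists>J\<subseteq>{1..n}. \<kappa>2 * real n \<le> real (card J) \<and>
      (\<forall>U\<subseteq>J. \<exists>\<phi>\<in>S. (\<forall>v\<in>U. dist (\<phi> v) p \<le> t) \<and> (\<forall>v\<in>J - U. t + \<gamma> \<le> dist (\<phi> v) p))"
      by (intro main) auto
  qed
qed

section \<open>Realizing patterns at a finite stage\<close>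

text \<open>
The form in which positive entropy enters the combinatorial part: finite models of arbitrary precision for the
maps \<open>g i\<close>, in exponential number and separated at scale \<open>e\<close>.  The maps \<open>\<alpha> i\<close> stand for \<open>\<sigma> j (s i)\<close>.
\<close>
definition rich_models ::
    "'x::metric_space set \<Rightarrow> (nat \<Rightarrow> 'x \<Rightarrow> 'x) \<Rightarrow> real \<Rightarrow> real \<Rightarrow> bool" where
  "rich_models X g e c \<longleftrightarrow> (\<forall>H n0 \<kappa> \<beta>. 0 < \<kappa> \<longrightarrow> 0 < \<beta> \<longrightarrow>
     (\<exists>n\<ge>n0. \<exists>\<alpha> S.
        (\<forall>i<H. bij_betw (\<alpha> i) {1..n} {1..n}) \<and>
        real (card {v\<in>{1..n}. \<not> inj_on (\<lambda>i. \<alpha> i v) {..<H}}) \<le> \<beta> * real n \<and>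
        finite S \<and> exp (c * real n) \<le> real (card S) \<and>
        (\<forall>\<phi>\<in>S. \<phi> ` {1..n} \<subseteq> X \<and>
          real (card {v\<in>{1..n}. \<exists>i<H. \<kappa> < dist (\<phi> (\<alpha> i v)) (g i (\<phi> v))}) \<le> \<beta> * real n) \<and>
        (\<forall>\<phi>\<in>S. \<forall>\<psi>\<in>S. \<phi> \<noteq> \<psi> \<longrightarrow> (\<exists>v\<in>{1..n}. e \<le> dist (\<phi> v) (\<psi> v)))))"

text \<open>
On the set \<open>I\<close> of times all 0-1-patterns are realized by points whose orbits are, up to the error
\<open>\<kappa>\<close>, near \<open>z k\<close> at the times \<open>b k\<close>.
\<close>
definition patterns_realized ::
    "'x::metric_space set \<Rightarrow> (nat \<Rightarrow> 'x \<Rightarrow> 'x) \<Rightarrow> 'x \<Rightarrow> real \<Rightarrow> real \<Rightarrow> (nat \<Rightarrow> real) \<Rightarrow> real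
      \<Rightarrow> nat set \<Rightarrow> nat \<Rightarrow> (nat \<Rightarrow> nat) \<Rightarrow> (nat \<Rightarrow> 'x) \<Rightarrow> bool" where
  "patterns_realized X g p t \<gamma> \<rho> \<kappa> I N b z \<longleftrightarrow>
     (\<forall>U\<subseteq>I. \<exists>x\<in>X. (\<forall>i\<in>U. dist (g i x) p \<le> t + \<kappa>) \<and>
        (\<forall>i\<in>I - U. t + \<gamma> - \<kappa> \<le> dist (g i x) p) \<and>
        (\<forall>k<N. dist (g (b k) x) (z k) \<le> \<rho> k + \<kappa>))"

text \<open>
The window lengths \<open>M k\<close> have to be chosen before \<open>N\<close> and the model, because the final limit runs over \<open>N\<close>.
The set \<open>R k\<close> may have density \<open>w k\<close>: this makes the number of colourings of all the \<open>R k\<close> by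
points of \<open>C k\<close> at most \<open>exp (c n / 8)\<close>.  It shall miss the window \<open>{k..<k + M k}\<close> for a
proportion of at most \<open>\<tau> k\<close> of the vertices only, with the \<open>\<tau> k\<close> summing up to at most \<open>q / 8\<close>.
Both demands can be met by \<open>small_hitting_set\<close> as soon as \<open>M k \<ge> 1 / (\<tau> k w k)\<close>.
The vertices of \<open>V\<close> are those which hit all the \<open>R k\<close>, move injectively and are not in the common set \<open>B\<close> of
bad vertices; they are so many that half of the density \<open>q\<close> of the preimages of \<open>J\<close> survives.
\<close>
lemma pattern_realization_stage:
  fixes X :: "'x::metric_space set" and g :: "nat \<Rightarrow> 'x \<Rightarrow> 'x" and C :: "nat \<Rightarrow> 'x set"
    and e c \<gamma> q :: real
  assumes rich: "rich_models X g e c" and c: "c > 0"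
    and C: "\<And>k. finite (C k)" "\<And>k. X \<subseteq> (\<Union>z\<in>C k. cball z (\<rho> k))"
    and q: "q > 0" 
    and indep: "\<forall>n\<ge>n0. \<forall>S :: (nat \<Rightarrow> 'x) set.
      finite S \<and> (\<forall>\<phi>\<in>S. \<phi> ` {1..n} \<subseteq> X) \<and> exp (c / 2 * real n) \<le> real (card S) \<and>
      (\<forall>\<phi>\<in>S. \<forall>\<psi>\<in>S. \<phi> \<noteq> \<psi> \<longrightarrow> (\<exists>v\<in>{1..n}. e \<le> dist (\<phi> v) (\<psi> v))) \<longrightarrow>
      (\<exists>p\<in>P. \<exists>t\<in>Q. \<exists>J\<subseteq>{1..n}. q * real n \<le> real (card J) \<and>
        (\<forall>U\<subseteq>J. \<exists>\<phi>\<in>S. (\<forall>v\<in>U. dist (\<phi> v) p \<le> t) \<and> (\<forall>v\<in>J - U. t + \<gamma> \<le> dist (\<phi> v) p)))"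
  shows "\<exists>M :: nat \<Rightarrow> nat. \<forall>N. \<forall>\<kappa>>0.
    \<exists>D V E p t. D > 0 \<and> finite (V :: nat set) \<and> real (card V) \<le> D \<and> p \<in> P \<and> t \<in> Q \<and>
    (\<forall>i<N. q / 2 * D \<le> real (card (V \<inter> E i))) \<and>
    (\<forall>v\<in>V. \<exists>b z. (\<forall>k<N. b k \<in> {k..<k + M k} \<and> z k \<in> C k) \<and>
      patterns_realized X g p t \<gamma> \<rho> \<kappa> {i. i < N \<and> v \<in> E i} N b z)"
proof -
  define l where "l k = ln (1 + real (card (C k)))" for k
  have l1: "real (card (C k)) \<le> exp (l k)" "0 \<le> l k" for k by (auto simp: l_def)
  define w where "w k = c / 8 * (1/2) ^ Suc k / (1 + l k)" for k
  define \<tau> where "\<tau> k = q / 8 * (1/2) ^ Suc k" for k :: nat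
  have w0: "w k > 0" for k using c l1(2)[of k] by (simp add: w_def)
  have t0: "\<tau> k > 0" for k using q by (simp add: \<tau>_def)
  have geo: "(\<Sum>k<N. (1/2::real) ^ Suc k) \<le> 1" for N
  proof -
    have "(\<Sum>k<N. (1/2::real) ^ Suc k) = 1 - (1/2) ^ N" by (induction N) auto
    then show ?thesis by simp
  qed
  have tsum: "(\<Sum>k<N. \<tau> k) \<le> q / 8" for N
  proof -
    have "(\<Sum>k<N. \<tau> k) = q / 8 * (\<Sum>k<N. (1/2) ^ Suc k)" unfolding \<tau>_def by (simp only: sum_distrib_left)
    also have "\<dots> \<le> q / 8 * 1" using geo q by (intro mult_left_mono) auto
    finally show ?thesis by simp
  qed
  have wsum: "(\<Sum>k<N. l k * w k) \<le> c / 8" for N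
  proof -
    have "(\<Sum>k<N. l k * w k) \<le> (\<Sum>k<N. c / 8 * (1/2) ^ Suc k)"
    proof (rule sum_mono)
      fix k
      have "l k / (1 + l k) * (c / 8 * (1/2) ^ Suc k) \<le> 1 * (c / 8 * (1/2) ^ Suc k)"
        using l1(2)[of k] c by (intro mult_right_mono) auto
      then show "l k * w k \<le> c / 8 * (1/2) ^ Suc k" by (simp add: w_def field_simps)
    qed
    also have "\<dots> = c / 8 * (\<Sum>k<N. (1/2) ^ Suc k)" by (simp only: sum_distrib_left)
    also have "\<dots> \<le> c / 8 * 1" using geo c by (intro mult_left_mono) auto
    finally show ?thesis by simp
  qed
  have "\<exists>M::nat. M > 0 \<and> 1 / (\<tau> k * w k) \<le> real M" for k
  proof -
    obtain M :: nat where "1 / (\<tau> k * w k) \<le> real M" using real_arch_simple by blast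
    then show ?thesis by (intro exI[of _ "Suc M"]) auto
  qed
  then obtain M :: "nat \<Rightarrow> nat" where M: "\<And>k. M k > 0" "\<And>k. 1 / (\<tau> k * w k) \<le> real (M k)" by metis
  obtain \<kappa>s where ks: "\<kappa>s > 0" and small: "\<And>Z :: nat set. finite Z \<Longrightarrow>
     real (card {Y. Y \<subseteq> Z \<and> real (card Y) \<le> \<kappa>s * real (card Z)}) \<le> exp (c / 8 * real (card Z))"
    using card_small_subsets[of "c / 8", where 'z=nat] c by auto
  define \<beta> where "\<beta> = min \<kappa>s (q / 16)"
  have b: "\<beta> > 0" "\<beta> \<le> \<kappa>s" "\<beta> \<le> q / 16" using ks q by (auto simp: \<beta>_def)
  show ?thesis
  proof (intro exI[of _ M] allI impI)
    fix N and \<kappa> :: real assume kap: "\<kappa> > 0"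
    \<comment> \<open>All times below \<open>N\<close> and all times of the first \<open>N\<close> windows are below \<open>H\<close>.\<close>
    define H where "H = N + (\<Sum>k<N. k + M k)"
    have HN: "N \<le> H" by (simp add: H_def)
    have HM: "k + M k \<le> H" if "k < N" for k
      using member_le_sum[of k "{..<N}" "\<lambda>k. k + M k"] that by (simp add: H_def)
    from rich[unfolded rich_models_def, rule_format, OF kap b(1), of "max n0 1" H]
    obtain n \<alpha> S where n: "n \<ge> max n0 1" and bij: "\<forall>i<H. bij_betw (\<alpha> i) {1..n} {1..n}"
      and ninj: "real (card {v\<in>{1..n}. \<not> inj_on (\<lambda>i. \<alpha> i v) {..<H}}) \<le> \<beta> * real n"
      and S: "finite S" "exp (c * real n) \<le> real (card S)"
      and Sm: "\<forall>\<phi>\<in>S. \<phi> ` {1..n} \<subseteq> X \<and>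
          real (card {v\<in>{1..n}. \<exists>i<H. \<kappa> < dist (\<phi> (\<alpha> i v)) (g i (\<phi> v))}) \<le> \<beta> * real n"
      and Ssep: "\<forall>\<phi>\<in>S. \<forall>\<psi>\<in>S. \<phi> \<noteq> \<psi> \<longrightarrow> (\<exists>v\<in>{1..n}. e \<le> dist (\<phi> v) (\<psi> v))"
      by (elim exE conjE)
    have SX: "\<phi> ` {1..n} \<subseteq> X" if "\<phi> \<in> S" for \<phi> using Sm that by blast
    have Sbad: "real (card {v\<in>{1..n}. \<exists>i<H. \<kappa> < dist (\<phi> (\<alpha> i v)) (g i (\<phi> v))}) \<le> \<beta> * real n" if "\<phi> \<in> S" for \<phi>
      using Sm that by blast
    have n1: "n > 0" using n by simp
    define bad where "bad \<phi> = {v\<in>{1..n}. \<exists>i<H. \<kappa> < dist (\<phi> (\<alpha> i v)) (g i (\<phi> v))}" for \<phi>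
    define V0 where "V0 = {v\<in>{1..n}. inj_on (\<lambda>i. \<alpha> i v) {..<H}}"
    have V0: "finite V0" "V0 \<subseteq> {1..n}" by (auto simp: V0_def)
    have cV0: "card V0 \<le> n" using card_mono[OF _ V0(2)] by simp
    have "\<exists>R\<subseteq>{1..n}. real (card R) \<le> w k * real n \<and>
       real (card {v\<in>V0. (\<lambda>i. \<alpha> i v) ` {k..<k + M k} \<inter> R = {}}) \<le> \<tau> k * real n" if k: "k < N" for k
    proof -
      have sub: "{k..<k + M k} \<subseteq> {..<H}" using HM[OF k] by auto
      have "\<exists>R\<subseteq>{1..n}. real (card R) * (\<tau> k * M k) \<le> real (card V0) \<and>
        real (card {v\<in>V0. (\<lambda>i. \<alpha> i v) ` {k..<k + M k} \<inter> R = {}}) \<le> \<tau> k * real (card {1..n})"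
      proof (rule small_hitting_set)
        fix v assume v: "v \<in> V0"
        show "(\<lambda>i. \<alpha> i v) ` {k..<k + M k} \<subseteq> {1..n}"
        proof (rule image_subsetI)
          fix i assume "i \<in> {k..<k + M k}"
          then have "bij_betw (\<alpha> i) {1..n} {1..n}" using sub bij by auto
          then show "\<alpha> i v \<in> {1..n}" using v V0(2) by (meson bij_betwE subsetD)
        qed
        have "inj_on (\<lambda>i. \<alpha> i v) {k..<k + M k}" using v sub by (auto simp: V0_def intro: inj_on_subset)
        then show "M k \<le> card ((\<lambda>i. \<alpha> i v) ` {k..<k + M k})" by (simp add: card_image)
      qed (use V0 t0 M in auto)
      then obtain R where R: "R \<subseteq> {1..n}" "real (card R) * (\<tau> k * M k) \<le> real (card V0)"
        "real (card {v\<in>V0. (\<lambda>i. \<alpha> i v) ` {k..<k + M k} \<inter> R = {}}) \<le> \<tau> k * real n" by auto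
      have "1 \<le> \<tau> k * M k * w k" using M(2)[of k] t0[of k] w0[of k] by (simp add: field_simps)
      then have "real (card R) * 1 \<le> real (card R) * (\<tau> k * M k * w k)" by (intro mult_left_mono) auto
      also have "\<dots> = real (card R) * (\<tau> k * M k) * w k" by simp
      also have "\<dots> \<le> real n * w k" using R(2) cV0 w0[of k] by (intro mult_right_mono) auto
      finally show ?thesis using R by (auto simp: mult.commute)
    qed
    then have "\<forall>k. \<exists>R. k < N \<longrightarrow> R \<subseteq> {1..n} \<and> real (card R) \<le> w k * real n \<and>
       real (card {v\<in>V0. (\<lambda>i. \<alpha> i v) ` {k..<k + M k} \<inter> R = {}}) \<le> \<tau> k * real n" by blast
    from this[unfolded choice_iff] obtain R where R': "\<forall>k. k < N \<longrightarrow> R k \<subseteq> {1..n} \<and> real (card (R k)) \<le> w k * real n \<and>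
       real (card {v\<in>V0. (\<lambda>i. \<alpha> i v) ` {k..<k + M k} \<inter> R k = {}}) \<le> \<tau> k * real n" by (elim exE)
    have R: "R k \<subseteq> {1..n}" "real (card (R k)) \<le> w k * real n"
      "real (card {v\<in>V0. (\<lambda>i. \<alpha> i v) ` {k..<k + M k} \<inter> R k = {}}) \<le> \<tau> k * real n" if "k < N" for k
      using R'[rule_format, OF that] by (simp_all only:)
    have finR: "finite (R k)" if "k < N" for k using R(1)[OF that] finite_subset by blast
    define col where "col k y = (SOME z. z \<in> C k \<and> dist z y \<le> \<rho> k)" for k y
    have col: "col k y \<in> C k \<and> dist (col k y) y \<le> \<rho> k" if y: "y \<in> X" for k y
    proof -
      obtain z where "z \<in> C k" "y \<in> cball z (\<rho> k)" using C(2)[of k] y by blast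
      then have "\<exists>z. z \<in> C k \<and> dist z y \<le> \<rho> k" by auto
      then show ?thesis unfolding col_def by (rule someI_ex)
    qed
    \<comment> \<open>A choice of this datum fixes the bad vertices of \<open>\<phi>\<close> and its colours on the sets \<open>R k\<close>.\<close>
    define dat where "dat \<phi> = (bad \<phi>, restrict (\<lambda>k. restrict (\<lambda>u. col k (\<phi> u)) (R k)) {..<N})" for \<phi>
    let ?B = "{Y. Y \<subseteq> {1..n} \<and> real (card Y) \<le> \<kappa>s * real (card {1..n})}"
    let ?F = "PiE {..<N} (\<lambda>k. PiE (R k) (\<lambda>_. C k))"
    have "\<exists>y\<in>?B \<times> ?F. exp (c / 2 * real n) \<le> real (card {\<phi>\<in>S. dat \<phi> = y})"
    proof (rule pigeonhole_fibre[where b="exp (c / 2 * real n)"])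
      show "finite (?B \<times> ?F)" using finR C(1) by (intro finite_cartesian_product finite_PiE) auto
      show "dat ` S \<subseteq> ?B \<times> ?F"
      proof (rule image_subsetI)
        fix \<phi> assume phi: "\<phi> \<in> S"
        have "real (card (bad \<phi>)) \<le> \<beta> * real n" using Sbad[OF phi] by (simp add: bad_def)
        also have "\<dots> \<le> \<kappa>s * real n" using b(2) by (intro mult_right_mono) auto
        finally have "bad \<phi> \<in> ?B" by (auto simp: bad_def)
        moreover have "col k (\<phi> u) \<in> C k" if "k < N" "u \<in> R k" for k u
        proof -
          have "\<phi> u \<in> X" using SX[OF phi] R(1)[OF that(1)] that(2) by blast
          then show ?thesis using col by blast
        qed
        ultimately show "dat \<phi> \<in> ?B \<times> ?F" by (simp add: dat_def)
      qed
      have cF: "real (card ?F) \<le> exp (c / 8 * real n)"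
      proof -
        have "real (card ?F) = (\<Prod>k<N. real (card (C k)) ^ card (R k))"
          using finR by (simp add: card_PiE)
        also have "\<dots> \<le> (\<Prod>k<N. exp (l k * w k * real n))"
        proof (rule prod_mono)
          fix k assume k: "k \<in> {..<N}"
          have "real (card (C k)) ^ card (R k) \<le> exp (l k) ^ card (R k)" using l1 by (intro power_mono) auto
          also have "\<dots> = exp (real (card (R k)) * l k)" by (simp add: exp_of_nat_mult)
          also have "\<dots> \<le> exp ((w k * real n) * l k)"
            unfolding exp_le_cancel_iff using R(2)[of k] k l1(2) by (intro mult_right_mono) auto
          also have "(w k * real n) * l k = l k * w k * real n" by simp
          finally show "0 \<le> real (card (C k)) ^ card (R k) \<and> real (card (C k)) ^ card (R k) \<le> exp (l k * w k * real n)" by simp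
        qed
        also have "\<dots> = exp ((\<Sum>k<N. l k * w k) * real n)" by (simp add: exp_sum sum_distrib_right)
        also have "\<dots> \<le> exp (c / 8 * real n)" unfolding exp_le_cancel_iff using wsum by (intro mult_right_mono) auto
        finally show ?thesis .
      qed
      have "real (card (?B \<times> ?F)) = real (card ?B) * real (card ?F)" by (simp add: card_cartesian_product)
      also have "\<dots> \<le> exp (c / 8 * real n) * exp (c / 8 * real n)"
        using small[of "{1..n}"] cF by (intro mult_mono) auto
      also have "\<dots> = exp (c / 4 * real n)" by (simp flip: exp_add)
      also have "\<dots> \<le> exp (c / 2 * real n)" using c by simp
      finally show "real (card (?B \<times> ?F)) \<le> exp (c / 2 * real n)" .
      show "exp (c / 2 * real n) * exp (c / 2 * real n) \<le> real (card S)" using S(2) by (simp flip: exp_add)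
      have "real (card S) > 0" using S(2) by (meson exp_gt_zero less_le_trans)
      then show "S \<noteq> {}" by auto
    qed (use S in auto)
    then obtain B f where Bf: "f \<in> ?F" and big: "exp (c / 2 * real n) \<le> real (card {\<phi>\<in>S. dat \<phi> = (B, f)})" by blast
    define S' where "S' = {\<phi>\<in>S. dat \<phi> = (B, f)}"
    have S': "S' \<subseteq> S" "finite S'" using S by (auto simp: S'_def)
    have S'B: "bad \<phi> = B" if "\<phi> \<in> S'" for \<phi> using that by (simp add: S'_def dat_def)
    have S'f: "col k (\<phi> u) = f k u" if "\<phi> \<in> S'" "k < N" "u \<in> R k" for \<phi> k u
    proof -
      have "f = restrict (\<lambda>k. restrict (\<lambda>u. col k (\<phi> u)) (R k)) {..<N}"
        using that(1) by (simp add: S'_def dat_def)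
      then show ?thesis using that by simp
    qed
    have "S' \<noteq> {}"
    proof
      assume "S' = {}"
      then have "exp (c / 2 * real n) \<le> 0" using big by (simp flip: S'_def)
      then show False by (simp add: not_le)
    qed
    then obtain \<phi>0 where phi0: "\<phi>0 \<in> S'" by blast
    have cB: "real (card B) \<le> \<beta> * real n"
      using Sbad[of \<phi>0] S'B[OF phi0] phi0 S' by (auto simp: bad_def)
    have "n0 \<le> n" using n by simp
    moreover have "finite S' \<and> (\<forall>\<phi>\<in>S'. \<phi> ` {1..n} \<subseteq> X) \<and> exp (c / 2 * real n) \<le> real (card S') \<and>
      (\<forall>\<phi>\<in>S'. \<forall>\<psi>\<in>S'. \<phi> \<noteq> \<psi> \<longrightarrow> (\<exists>v\<in>{1..n}. e \<le> dist (\<phi> v) (\<psi> v)))"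
    proof (intro conjI)
      show "exp (c / 2 * real n) \<le> real (card S')" using big by (simp only: S'_def)
      show "\<forall>\<phi>\<in>S'. \<phi> ` {1..n} \<subseteq> X" using SX S'(1) by blast
      show "\<forall>\<phi>\<in>S'. \<forall>\<psi>\<in>S'. \<phi> \<noteq> \<psi> \<longrightarrow> (\<exists>v\<in>{1..n}. e \<le> dist (\<phi> v) (\<psi> v))"
        using Ssep S'(1) by blast
    qed (rule S'(2))
    ultimately have "\<exists>p\<in>P. \<exists>t\<in>Q. \<exists>J\<subseteq>{1..n}. q * real n \<le> real (card J) \<and>
        (\<forall>U\<subseteq>J. \<exists>\<phi>\<in>S'. (\<forall>v\<in>U. dist (\<phi> v) p \<le> t) \<and> (\<forall>v\<in>J - U. t + \<gamma> \<le> dist (\<phi> v) p))"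
      by (rule indep[rule_format])
    then obtain p t J where pt: "p \<in> P" "t \<in> Q" and J: "J \<subseteq> {1..n}" "q * real n \<le> real (card J)"
      and free: "\<forall>U\<subseteq>J. \<exists>\<phi>\<in>S'. (\<forall>v\<in>U. dist (\<phi> v) p \<le> t) \<and> (\<forall>v\<in>J - U. t + \<gamma> \<le> dist (\<phi> v) p)"
      by (elim bexE exE conjE)
    define V where "V = {v\<in>V0. v \<notin> B \<and> (\<forall>k<N. (\<lambda>i. \<alpha> i v) ` {k..<k + M k} \<inter> R k \<noteq> {})}"
    define E where "E i = {v\<in>{1..n}. \<alpha> i v \<in> J}" for i
    have V: "V \<subseteq> {1..n}" "finite V" using V0 by (auto simp: V_def)
    have cV: "real (card V) \<le> real n" using card_mono[OF _ V(1)] by simp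
    have cNV: "real (card ({1..n} - V)) \<le> q / 4 * real n"
    proof -
      define A1 where "A1 = {v\<in>{1..n}. \<not> inj_on (\<lambda>i. \<alpha> i v) {..<H}}"
      define A2 where "A2 k = {v\<in>V0. (\<lambda>i. \<alpha> i v) ` {k..<k + M k} \<inter> R k = {}}" for k
      have finA: "finite A1" "finite B" "finite (A2 k)" for k
        using V0 S'B[OF phi0] by (auto simp: A1_def A2_def bad_def)
      have "{1..n} - V \<subseteq> A1 \<union> B \<union> (\<Union>k<N. A2 k)"
        by (auto simp: V_def A1_def A2_def V0_def)
      then have "card ({1..n} - V) \<le> card (A1 \<union> B \<union> (\<Union>k<N. A2 k))"
        using finA by (intro card_mono) auto
      also have "\<dots> \<le> card A1 + card B + card (\<Union>k<N. A2 k)"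
        by (meson card_Un_le add_le_mono le_refl order_trans)
      also have "\<dots> \<le> card A1 + card B + (\<Sum>k<N. card (A2 k))"
        by (intro add_left_mono card_UN_le) simp
      finally have "real (card ({1..n} - V)) \<le> real (card A1) + real (card B) + (\<Sum>k<N. real (card (A2 k)))"
        by (metis (mono_tags) of_nat_add of_nat_le_iff of_nat_sum)
      also have "\<dots> \<le> \<beta> * real n + \<beta> * real n + (\<Sum>k<N. \<tau> k * real n)"
        using ninj cB R(3) by (intro add_mono sum_mono) (auto simp: A1_def A2_def)
      also have "\<dots> = (2 * \<beta> + (\<Sum>k<N. \<tau> k)) * real n" by (simp add: distrib_right sum_distrib_right)
      also have "\<dots> \<le> (q / 4) * real n" using b(3) tsum[of N] by (intro mult_right_mono) auto
      finally show ?thesis .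
    qed
    have cE: "q / 2 * real n \<le> real (card (V \<inter> E i))" if i: "i < N" for i
    proof -
      have bi: "bij_betw (\<alpha> i) {1..n} {1..n}" using bij i HN by simp
      have "\<alpha> i ` E i = J"
      proof
        show "\<alpha> i ` E i \<subseteq> J" by (auto simp: E_def)
        show "J \<subseteq> \<alpha> i ` E i"
        proof
          fix u assume u: "u \<in> J"
          then have "u \<in> \<alpha> i ` {1..n}" using J(1) bi by (auto simp: bij_betw_def)
          then show "u \<in> \<alpha> i ` E i" using u by (auto simp: E_def)
        qed
      qed
      then have "card J \<le> card (E i)" using card_image_le[of "E i" "\<alpha> i"] by (simp add: E_def)
      also have "E i \<subseteq> (V \<inter> E i) \<union> ({1..n} - V)" by (auto simp: E_def)
      then have "card (E i) \<le> card ((V \<inter> E i) \<union> ({1..n} - V))" using V by (intro card_mono) auto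
      also have "\<dots> \<le> card (V \<inter> E i) + card ({1..n} - V)" by (rule card_Un_le)
      finally have "real (card J) \<le> real (card (V \<inter> E i)) + real (card ({1..n} - V))"
        by (metis of_nat_add of_nat_le_iff)
      moreover have "q * real n = q / 2 * real n + q / 4 * real n + q / 4 * real n" by simp
      moreover have "0 \<le> q / 4 * real n" using q by simp
      ultimately show ?thesis using J(2) cNV by linarith
    qed
    have pts: "\<exists>b z. (\<forall>k<N. b k \<in> {k..<k + M k} \<and> z k \<in> C k) \<and>
        patterns_realized X g p t \<gamma> \<rho> \<kappa> {i. i < N \<and> v \<in> E i} N b z" if v: "v \<in> V" for v
    proof -
      have v0: "v \<in> {1..n}" "v \<notin> B" and injv: "inj_on (\<lambda>i. \<alpha> i v) {..<H}"
        using v by (auto simp: V_def V0_def)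
      have "\<exists>i. k < N \<longrightarrow> i \<in> {k..<k + M k} \<and> \<alpha> i v \<in> R k" for k using v by (auto simp: V_def)
      then obtain \<iota> where io: "\<And>k. k < N \<Longrightarrow> \<iota> k \<in> {k..<k + M k} \<and> \<alpha> (\<iota> k) v \<in> R k" by metis
      define \<zeta> where "\<zeta> k = f k (\<alpha> (\<iota> k) v)" for k
      have chi: "\<zeta> k \<in> C k" if "k < N" for k
        using Bf io[OF that] that unfolding \<zeta>_def by (meson PiE_mem lessThan_iff)
      have point: "\<exists>x\<in>X. (\<forall>i\<in>U. dist (g i x) p \<le> t + \<kappa>) \<and>
        (\<forall>i\<in>{i. i < N \<and> v \<in> E i} - U. t + \<gamma> - \<kappa> \<le> dist (g i x) p) \<and>
        (\<forall>k<N. dist (g (\<iota> k) x) (\<zeta> k) \<le> \<rho> k + \<kappa>)" if U: "U \<subseteq> {i. i < N \<and> v \<in> E i}" for U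
      proof -
        have "(\<lambda>i. \<alpha> i v) ` U \<subseteq> J" using U by (auto simp: E_def)
        from free[rule_format, OF this] obtain \<phi> where phi: "\<phi> \<in> S'"
          and lo: "\<And>i. i \<in> U \<Longrightarrow> dist (\<phi> (\<alpha> i v)) p \<le> t"
          and hi: "\<And>u. u \<in> J - (\<lambda>i. \<alpha> i v) ` U \<Longrightarrow> t + \<gamma> \<le> dist (\<phi> u) p" by auto
        have phiX: "\<phi> ` {1..n} \<subseteq> X" using phi S' SX by blast
        have near: "dist (\<phi> (\<alpha> i v)) (g i (\<phi> v)) \<le> \<kappa>" if "i < H" for i
        proof (rule ccontr)
          assume "\<not> ?thesis"
          then have "v \<in> bad \<phi>" using that v0 unfolding bad_def by auto
          then show False using S'B[OF phi] v0 by simp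
        qed
        show ?thesis
        proof (intro bexI[of _ "\<phi> v"] conjI ballI allI impI)
          fix i assume i: "i \<in> U"
          then have "i < H" using U HN by auto
          then show "dist (g i (\<phi> v)) p \<le> t + \<kappa>"
            using near[of i] lo[OF i] dist_triangle2[of "g i (\<phi> v)" p "\<phi> (\<alpha> i v)"]
              dist_triangle[of "g i (\<phi> v)" p "\<phi> (\<alpha> i v)"] by (simp add: dist_commute)
        next
          fix i assume "i \<in> {i. i < N \<and> v \<in> E i} - U"
          then have i: "i < N \<and> v \<in> E i \<and> i \<notin> U" by blast
          then have iH: "i < H" using HN by auto
          have "\<alpha> i v \<notin> (\<lambda>i. \<alpha> i v) ` U"
          proof
            assume "\<alpha> i v \<in> (\<lambda>i. \<alpha> i v) ` U"
            then obtain j where j: "j \<in> U" "\<alpha> i v = \<alpha> j v" by auto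
            then have "j < H" using U HN by auto
            with j iH have "i = j" using inj_onD[OF injv, of i j] by simp
            with j i show False by simp
          qed
          moreover have "\<alpha> i v \<in> J" using i by (simp add: E_def)
          ultimately have "t + \<gamma> \<le> dist (\<phi> (\<alpha> i v)) p" using hi by blast
          then show "t + \<gamma> - \<kappa> \<le> dist (g i (\<phi> v)) p"
            using near[OF iH] dist_triangle[of "\<phi> (\<alpha> i v)" p "g i (\<phi> v)"] by linarith
        next
          fix k assume k: "k < N"
          have "\<iota> k < H" using io[OF k] HM[OF k] by auto
          then have 1: "dist (\<phi> (\<alpha> (\<iota> k) v)) (g (\<iota> k) (\<phi> v)) \<le> \<kappa>" by (rule near)
          have "\<phi> (\<alpha> (\<iota> k) v) \<in> X" using io[OF k] R(1)[OF k] phiX by blast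
          then have "dist (\<zeta> k) (\<phi> (\<alpha> (\<iota> k) v)) \<le> \<rho> k"
            using col S'f[OF phi k] io[OF k] unfolding \<zeta>_def by metis
          with 1 show "dist (g (\<iota> k) (\<phi> v)) (\<zeta> k) \<le> \<rho> k + \<kappa>"
            using dist_triangle[of "g (\<iota> k) (\<phi> v)" "\<zeta> k" "\<phi> (\<alpha> (\<iota> k) v)"] by (simp add: dist_commute)
        next
          show "\<phi> v \<in> X" using phiX v0 by blast
        qed
      qed
      have "patterns_realized X g p t \<gamma> \<rho> \<kappa> {i. i < N \<and> v \<in> E i} N \<iota> \<zeta>"
        unfolding patterns_realized_def by (intro allI impI point)
      then show ?thesis using io chi by blast
    qed
    show "\<exists>D V E p t. D > 0 \<and> finite (V :: nat set) \<and> real (card V) \<le> D \<and> p \<in> P \<and> t \<in> Q \<and>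
    (\<forall>i<N. q / 2 * D \<le> real (card (V \<inter> E i))) \<and>
    (\<forall>v\<in>V. \<exists>b z. (\<forall>k<N. b k \<in> {k..<k + M k} \<and> z k \<in> C k) \<and>
      patterns_realized X g p t \<gamma> \<rho> \<kappa> {i. i < N \<and> v \<in> E i} N b z)"
      by (rule exI[of _ "real n"], rule exI[of _ V], rule exI[of _ E], rule exI[of _ p], rule exI[of _ t],
          intro conjI ballI allI impI V(2) cV pt cE pts) (use n1 in auto)
  qed
qed

section \<open>Recurrence to sets of positive density\<close>

lemma bounded_pointwise_convergent_subseq:
  fixes f :: "nat \<Rightarrow> nat \<Rightarrow> real"
  assumes "\<And>N n. \<bar>f N n\<bar> \<le> B"
  shows "\<exists>r p. strict_mono (r :: nat \<Rightarrow> nat) \<and> (\<forall>n. (\<lambda>N. f (r N) n) \<longlonglongrightarrow> p n)"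
proof -
  interpret subseqs "\<lambda>n s. convergent (\<lambda>N. f (s N) n)"
  proof
    fix n and s :: "nat \<Rightarrow> nat"
    have "compact {-B..B}" by simp
    moreover have "f (s N) n \<in> {-B..B}" for N using assms[of "s N" n] by (simp add: abs_le_iff)
    ultimately obtain l r where "strict_mono r" "((\<lambda>N. f (s N) n) \<circ> r) \<longlonglongrightarrow> l"
      unfolding compact_def by meson
    then show "\<exists>r'. strict_mono r' \<and> convergent (\<lambda>N. f ((s \<circ> r') N) n)"
      by (auto simp: convergent_def o_def)
  qed
  have "convergent (\<lambda>N. f (diagseq N) n)" for n
  proof -
    have "convergent (\<lambda>N. f ((diagseq \<circ> ((+) (Suc n))) N) n)"
    proof (rule diagseq_holds)
      fix r s :: "nat \<Rightarrow> nat" and n assume r: "strict_mono r" and c: "convergent (\<lambda>N. f (s N) n)"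
      show "convergent (\<lambda>N. f ((s \<circ> r) N) n)"
        using convergent_subseq_convergent[OF c r] by (simp add: o_def)
    qed
    then have "convergent (\<lambda>N. f (diagseq (N + Suc n)) n)" by (simp add: o_def add.commute)
    then show ?thesis by (subst (asm) convergent_ignore_initial_segment)
  qed
  then have "\<forall>n. \<exists>l. (\<lambda>N. f (diagseq N) n) \<longlonglongrightarrow> l" by (simp add: convergent_def)
  then obtain p where "\<forall>n. (\<lambda>N. f (diagseq N) n) \<longlonglongrightarrow> p n" by metis
  with subseq_diagseq show ?thesis by blast
qed

lemma finite_ranges_stabilizing_subseq:
  fixes f :: "nat \<Rightarrow> nat \<Rightarrow> 'b"
  assumes "\<And>n. finite (range (\<lambda>N. f N n))"
  shows "\<exists>r g. strict_mono (r :: nat \<Rightarrow> nat) \<and> (\<forall>n. \<forall>N>n. f (r N) n = g n)"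
proof -
  interpret subseqs "\<lambda>n s. \<exists>c. \<forall>N. f (s N) n = c"
  proof
    fix n and s :: "nat \<Rightarrow> nat" assume "strict_mono s"
    have "finite (range (\<lambda>N. f (s N) n))" by (rule finite_subset[OF _ assms[of n]]) auto
    then obtain c where "infinite {N. f (s N) n = c}"
      using pigeonhole_infinite[of UNIV "\<lambda>N. f (s N) n"] by auto
    then obtain r' :: "nat \<Rightarrow> nat" where "strict_mono r'" "\<And>N. r' N \<in> {N. f (s N) n = c}"
      using infinite_enumerate by blast
    then have r': "strict_mono r'" and "\<forall>N. f ((s \<circ> r') N) n = c" by simp_all
    then have c': "\<exists>c'. \<forall>N. f ((s \<circ> r') N) n = c'" by (intro exI)
    show "\<exists>r' :: nat \<Rightarrow> nat. strict_mono r' \<and> (\<exists>c'. \<forall>N. f ((s \<circ> r') N) n = c')"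
      by (rule exI[of _ r'], rule conjI[OF r' c'])
  qed
  have "\<exists>c. \<forall>N. f ((diagseq \<circ> ((+) (Suc n))) N) n = c" for n
    by (rule diagseq_holds) auto
  then obtain g where g: "\<And>n N. f (diagseq (Suc n + N)) n = g n" unfolding o_def by metis
  have "f (diagseq N) n = g n" if "N > n" for n N
    using g[of n "N - Suc n"] that by simp
  with subseq_diagseq show ?thesis by blast
qed

text \<open>
Fatou's lemma without a limit measure.  The proportion of \<open>V N\<close> visited during the times \<open>{x..<y}\<close> converges along a
subsequence to some \<open>p x y\<close>; let \<open>u x\<close> be the supremum over \<open>y\<close>, the limit proportion visited at some time after \<open>x\<close>.
It decreases to some \<open>\<theta> \<ge> q\<close>.  The end points \<open>m k\<close> are chosen such that the window starting at \<open>m k\<close> exhausts \<open>u (m k)\<close> up to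
\<open>\<delta> k\<close>.  So among the vertices visited after \<open>m k\<close>, in particular among those visited in a later window, a proportion of at most
\<open>\<delta> k\<close> misses the \<open>k\<close>-th window, and the \<open>\<delta> k\<close> sum up to at most \<open>\<theta> / 4\<close>.
\<close>
theorem recurrent_windows:
  fixes V :: "nat \<Rightarrow> 'v set" and E :: "nat \<Rightarrow> nat \<Rightarrow> 'v set" and D :: "nat \<Rightarrow> real" and q :: real
  assumes q: "q > 0" and D: "\<And>N. D N > 0" and fin: "\<And>N. finite (V N)"
    and VD: "\<And>N. real (card (V N)) \<le> D N"
    and E: "\<And>N i. i < N \<Longrightarrow> q * D N \<le> real (card (V N \<inter> E N i))"
  shows "\<exists>m :: nat \<Rightarrow> nat. strict_mono m \<and>
    (\<forall>K. \<exists>N\<ge>K. \<exists>v\<in>V N. \<forall>k<K. \<exists>i\<in>{m k..<m (Suc k)}. v \<in> E N i)"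
proof -
  define W where "W N x y = V N \<inter> (\<Union>i\<in>{x..<y}. E N i)" for N x y
  define a where "a N x y = real (card (W N x y)) / D N" for N x y
  have finW: "finite (W N x y)" for N x y using fin by (simp add: W_def)
  have a0: "0 \<le> a N x y" for N x y using D[of N] by (simp add: a_def)
  have a1: "a N x y \<le> 1" for N x y
  proof -
    have "card (W N x y) \<le> card (V N)" using fin by (intro card_mono) (auto simp: W_def)
    with VD[of N] have "real (card (W N x y)) \<le> D N" by linarith
    then show ?thesis using D[of N] by (simp add: a_def)
  qed
  have amono: "a N x y \<le> a N x' y'" if "x' \<le> x" "y \<le> y'" for N x y x' y'
  proof -
    have "W N x y \<subseteq> W N x' y'" using that by (fastforce simp: W_def)
    then have "real (card (W N x y)) \<le> real (card (W N x' y'))" using finW by (simp add: card_mono)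
    then show ?thesis using D[of N] by (simp add: a_def divide_right_mono)
  qed
  have "\<bar>case prod_decode n of (x, y) \<Rightarrow> a N x y\<bar> \<le> 1" for N n
    using a0 a1 by (simp split: prod.split)
  from bounded_pointwise_convergent_subseq[of "\<lambda>N n. (case prod_decode n of (x, y) \<Rightarrow> a N x y)", OF this]
  obtain r p' where r: "strict_mono r"
    and p': "\<And>n. (\<lambda>N. (case prod_decode n of (x, y) \<Rightarrow> a (r N) x y)) \<longlonglongrightarrow> p' n"
    by metis
  define p where "p x y = p' (prod_encode (x, y))" for x y
  have p: "(\<lambda>N. a (r N) x y) \<longlonglongrightarrow> p x y" for x y
    using p'[of "prod_encode (x, y)"] by (simp add: p_def)
  have p1: "p x y \<le> 1" for x y using a1 by (intro LIMSEQ_le_const2[OF p]) auto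
  have pmono: "p x y \<le> p x' y'" if "x' \<le> x" "y \<le> y'" for x y x' y'
    using amono[OF that] by (intro LIMSEQ_le[OF p p]) auto
  have pq: "q \<le> p x (Suc x)" for x
  proof (rule LIMSEQ_le_const[OF p], intro exI allI impI)
    fix N assume "N \<ge> Suc x"
    then have "x < r N" using seq_suble[OF r, of N] by linarith
    then have "q * D (r N) \<le> real (card (W (r N) x (Suc x)))" using E by (simp add: W_def)
    then show "q \<le> a (r N) x (Suc x)" using D[of "r N"] by (simp add: a_def field_simps)
  qed
  define u where "u x = (SUP y. p x y)" for x
  have bdd: "bdd_above (range (p x))" for x using p1 by (auto intro!: bdd_aboveI)
  have pu: "p x y \<le> u x" for x y unfolding u_def using bdd by (intro cSUP_upper) auto
  have umono: "u x \<le> u x'" if "x' \<le> x" for x x'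
    unfolding u_def using that bdd by (intro cSUP_mono) (auto intro: pmono)
  define \<theta> where "\<theta> = (INF x. u x)"
  have uq: "q \<le> u x" for x using pq[of x] pu[of x "Suc x"] by linarith
  have bddu: "bdd_below (range u)" using uq by (auto intro!: bdd_belowI)
  have th: "\<theta> \<ge> q" unfolding \<theta>_def using uq by (intro cINF_greatest) auto
  have thu: "\<theta> \<le> u x" for x unfolding \<theta>_def using bddu by (intro cINF_lower) auto
  define \<delta> where "\<delta> k = \<theta> / 4 * (1/2) ^ Suc k" for k :: nat
  have d0: "\<delta> k > 0" for k using th q by (simp add: \<delta>_def)
  have small: "\<exists>x\<ge>x0. u x < \<theta> + \<delta> k" for k x0
  proof -
    have "\<theta> < \<theta> + \<delta> k" using d0 by simp
    then obtain x where "u x < \<theta> + \<delta> k"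
      using cInf_lessD[of "range u" "\<theta> + \<delta> k"] by (auto simp: \<theta>_def)
    then have "u (max x x0) < \<theta> + \<delta> k" using umono[of x "max x x0"] by simp
    then show ?thesis by (intro exI[of _ "max x x0"]) auto
  qed
  have "\<exists>m. \<forall>k. u (m k) < \<theta> + \<delta> k \<and> (m k < m (Suc k) \<and> u (m k) - \<delta> k < p (m k) (m (Suc k)))"
  proof (rule dependent_nat_choice)
    show "\<exists>x. u x < \<theta> + \<delta> 0" using small by blast
    fix x k assume "u x < \<theta> + \<delta> k"
    have "u x - \<delta> k < u x" using d0 by simp
    then obtain y where y: "u x - \<delta> k < p x y"
      unfolding u_def using bdd[of x] by (auto simp: less_cSUP_iff)
    obtain z where z: "z \<ge> max y (Suc x)" "u z < \<theta> + \<delta> (Suc k)" using small by blast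
    with y pmono[of x x y z] show "\<exists>z. u z < \<theta> + \<delta> (Suc k) \<and> x < z \<and> u x - \<delta> k < p x z"
      by (intro exI[of _ z]) auto
  qed
  then obtain m where m: "\<And>k. u (m k) < \<theta> + \<delta> k" "\<And>k. m k < m (Suc k)"
    "\<And>k. u (m k) - \<delta> k < p (m k) (m (Suc k))" by blast
  have sm: "strict_mono m" using m(2) by (simp add: strict_mono_Suc_iff)
  have half_sum: "(\<Sum>j<K. \<delta> j) \<le> \<theta> / 4" for K
  proof -
    have "(\<Sum>j<K. (1/2::real) ^ Suc j) = 1 - (1/2) ^ K" by (induction K) auto
    then have "(\<Sum>j<K. \<delta> j) = \<theta> / 4 * (1 - (1/2) ^ K)"
      unfolding \<delta>_def by (simp only: flip: sum_distrib_left)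
    also have "\<dots> \<le> \<theta> / 4 * 1" using th q by (intro mult_left_mono) auto
    finally show ?thesis by simp
  qed
  have pos_case: "\<exists>N\<ge>K. \<exists>v\<in>V N. \<forall>k<K. \<exists>i\<in>{m k..<m (Suc k)}. v \<in> E N i" if K: "K > 0" for K
  proof -
    define L where "L = K - 1"
    have KL: "K = Suc L" using K by (simp add: L_def)
    let ?x = "\<lambda>N. a (r N) (m L) (m K) - (\<Sum>j<K. a (r N) (m j) (m K) - a (r N) (m j) (m (Suc j)))"
    have "?x \<longlonglongrightarrow> p (m L) (m K) - (\<Sum>j<K. p (m j) (m K) - p (m j) (m (Suc j)))"
      by (intro tendsto_intros p)
    moreover have "0 < p (m L) (m K) - (\<Sum>j<K. p (m j) (m K) - p (m j) (m (Suc j)))"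
    proof -
      have "(\<Sum>j<K. p (m j) (m K) - p (m j) (m (Suc j))) \<le> (\<Sum>j<K. \<delta> j)"
      proof (rule sum_mono)
        fix j show "p (m j) (m K) - p (m j) (m (Suc j)) \<le> \<delta> j"
          using pu[of "m j" "m K"] m(3)[of j] by linarith
      qed
      moreover have "\<theta> - \<delta> L < p (m L) (m K)" using m(3)[of L] thu[of "m L"] by (simp add: KL)
      moreover have "\<delta> L \<le> \<theta> / 4"
      proof -
        have "\<delta> L \<le> (\<Sum>j<K. \<delta> j)" unfolding KL using d0 by (intro member_le_sum) (auto simp: less_imp_le)
        with half_sum[of K] show ?thesis by linarith
      qed
      ultimately show ?thesis using half_sum[of K] th q by linarith
    qed
    ultimately have "eventually (\<lambda>N. 0 < ?x N) sequentially" by (rule order_tendstoD(1))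
    then obtain N0 where "\<And>N. N \<ge> N0 \<Longrightarrow> 0 < ?x N" by (auto simp: eventually_sequentially)
    then have pos: "0 < ?x (max N0 K)" by simp
    define M where "M = r (max N0 K)"
    have MK: "K \<le> M" using seq_suble[OF r, of "max N0 K"] by (simp add: M_def)
    \<comment> \<open>Vertices of the last window that miss the \<open>j\<close>-th one are visited after \<open>m j\<close> but not within \<open>{m j..<m (Suc j)}\<close>.\<close>
    have "\<exists>v\<in>W M (m L) (m K). \<forall>j<K. v \<in> W M (m j) (m (Suc j))"
    proof (rule ccontr)
      assume no: "\<not> ?thesis"
      have "W M (m L) (m K) \<subseteq> (\<Union>j<K. W M (m j) (m K) - W M (m j) (m (Suc j)))"
      proof
        fix v assume v: "v \<in> W M (m L) (m K)"
        with no obtain j where j: "j < K" "v \<notin> W M (m j) (m (Suc j))" by blast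
        have "m j \<le> m L" using j sm by (simp add: KL strict_mono_less_eq)
        then have "v \<in> W M (m j) (m K)" using v by (fastforce simp: W_def)
        with j show "v \<in> (\<Union>j<K. W M (m j) (m K) - W M (m j) (m (Suc j)))" by blast
      qed
      then have "card (W M (m L) (m K)) \<le> card (\<Union>j<K. W M (m j) (m K) - W M (m j) (m (Suc j)))"
        using finW by (intro card_mono) auto
      also have "\<dots> \<le> (\<Sum>j<K. card (W M (m j) (m K) - W M (m j) (m (Suc j))))"
        by (rule card_UN_le) simp
      finally have "real (card (W M (m L) (m K))) \<le> (\<Sum>j<K. real (card (W M (m j) (m K) - W M (m j) (m (Suc j)))))"
        by (simp flip: of_nat_sum)
      also have "\<dots> = (\<Sum>j<K. real (card (W M (m j) (m K))) - real (card (W M (m j) (m (Suc j)))))"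
      proof (rule sum.cong[OF refl])
        fix j assume "j \<in> {..<K}"
        then have "m (Suc j) \<le> m K" using sm by (simp add: strict_mono_less_eq Suc_le_eq)
        then have "W M (m j) (m (Suc j)) \<subseteq> W M (m j) (m K)" by (fastforce simp: W_def)
        then show "real (card (W M (m j) (m K) - W M (m j) (m (Suc j))))
            = real (card (W M (m j) (m K))) - real (card (W M (m j) (m (Suc j))))"
          using finW by (simp add: card_Diff_subset of_nat_diff card_mono)
      qed
      finally have "real (card (W M (m L) (m K))) / D M
          \<le> (\<Sum>j<K. real (card (W M (m j) (m K))) - real (card (W M (m j) (m (Suc j))))) / D M"
        using D[of M] by (simp add: divide_right_mono)
      then have "a M (m L) (m K) \<le> (\<Sum>j<K. a M (m j) (m K) - a M (m j) (m (Suc j)))"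
        unfolding a_def sum_divide_distrib diff_divide_distrib .
      with pos show False by (simp add: M_def)
    qed
    then obtain v where v: "v \<in> W M (m L) (m K)" "\<And>j. j < K \<Longrightarrow> v \<in> W M (m j) (m (Suc j))" by blast
    then have "v \<in> V M" "\<And>j. j < K \<Longrightarrow> \<exists>i\<in>{m j..<m (Suc j)}. v \<in> E M i" by (auto simp: W_def)
    with MK show ?thesis by blast
  qed
  have "\<exists>N\<ge>K. \<exists>v\<in>V N. \<forall>k<K. \<exists>i\<in>{m k..<m (Suc k)}. v \<in> E N i" for K
    using pos_case[of "Suc K"] by (meson Suc_leD less_SucI zero_less_Suc)
  with sm show ?thesis by blast
qed

section \<open>Free and proximal times\<close>

lemma le_of_subseq_limit:
  fixes h :: "'x::metric_space \<Rightarrow> real"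
  assumes h: "continuous_on X h" and xs: "\<And>K. xs K \<in> X" "x \<in> X" and s: "strict_mono s"
    and lim: "(xs \<circ> s) \<longlonglongrightarrow> x" and le: "\<And>K. K > k \<Longrightarrow> h (xs K) \<le> b + 1 / real (Suc K)"
  shows "h x \<le> b"
proof -
  have "(\<lambda>K. h ((xs \<circ> s) K)) \<longlonglongrightarrow> h x"
    using xs by (intro continuous_on_tendsto_compose[OF h lim]) simp_all
  moreover have "(\<lambda>K. b + 1 / real (Suc K)) \<longlonglongrightarrow> b + 0"
    by (intro tendsto_intros LIMSEQ_Suc lim_1_over_n)
  moreover have "\<exists>N. \<forall>K\<ge>N. h ((xs \<circ> s) K) \<le> b + 1 / real (Suc K)"
  proof (intro exI allI impI)
    fix K assume "K \<ge> Suc k"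
    have sK: "K \<le> s K" using seq_suble[OF s] .
    then have "h (xs (s K)) \<le> b + 1 / real (Suc (s K))" using \<open>K \<ge> Suc k\<close> by (intro le) simp
    also have "1 / real (Suc (s K)) \<le> 1 / real (Suc K)" using sK by (simp add: frac_le)
    finally show "h ((xs \<circ> s) K) \<le> b + 1 / real (Suc K)" by simp
  qed
  ultimately have "h x \<le> b + 0" by (rule LIMSEQ_le)
  then show ?thesis by simp
qed

text \<open>
The vertices supplied by the finite stages depend on the stage, but the times at which they visit a given window, and the
centres and thresholds involved, range over finite sets that do not.  Along a subsequence they stabilize; the points then
converge by compactness.  The constant \<open>\<gamma>\<close> comes from \<open>separated_models_independent\<close> and is therefore the same for
all \<open>g\<close>.
\<close>
theorem free_and_proximal_times:
  fixes X :: "'x::metric_space set" and e c :: real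
  assumes X: "compact X" and e: "e > 0" and c: "c > 0"
  shows "\<exists>\<gamma>>0. \<forall>g. rich_models X g e c \<longrightarrow> (\<forall>i. continuous_on X (g i)) \<longrightarrow>
    (\<exists>p t a b z. strict_mono (a :: nat \<Rightarrow> nat) \<and> (\<forall>k. k \<le> b k) \<and>
      (\<forall>\<tau> :: nat \<Rightarrow> bool. \<exists>x\<in>X. (\<forall>k. if \<tau> k then dist (g (a k) x) p \<le> t else t + \<gamma> \<le> dist (g (a k) x) p) \<and>
        (\<forall>k. dist (g (b k) x) (z k) \<le> 1 / real (Suc k))))"
proof -
  have cover: "\<exists>P. finite P \<and> X \<subseteq> (\<Union>p\<in>P. ball p r)" if "r > 0" for r
    using compactE_image[OF X, of X "\<lambda>p. ball p r"] that
    by (metis (no_types, lifting) UN_I centre_in_ball open_ball subsetI)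
  obtain P where P: "finite P" "X \<subseteq> (\<Union>p\<in>P. ball p (e/4))" using cover[of "e/4"] e by auto
  have c2: "c / 2 > 0" using c by simp
  from separated_models_independent[OF e c2 P]
  obtain \<gamma> q Q n0 where gam: "\<gamma> > 0" and q: "q > 0" and Q: "finite Q" and indep: "\<forall>n\<ge>n0. \<forall>S :: (nat \<Rightarrow> 'x) set.
    finite S \<and> (\<forall>\<phi>\<in>S. \<phi> ` {1..n} \<subseteq> X) \<and> exp (c / 2 * real n) \<le> real (card S) \<and>
    (\<forall>\<phi>\<in>S. \<forall>\<psi>\<in>S. \<phi> \<noteq> \<psi> \<longrightarrow> (\<exists>v\<in>{1..n}. e \<le> dist (\<phi> v) (\<psi> v))) \<longrightarrow>
    (\<exists>p\<in>P. \<exists>t\<in>Q. \<exists>J\<subseteq>{1..n}. q * real n \<le> real (card J) \<and>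
      (\<forall>U\<subseteq>J. \<exists>\<phi>\<in>S. (\<forall>v\<in>U. dist (\<phi> v) p \<le> t) \<and> (\<forall>v\<in>J - U. t + \<gamma> \<le> dist (\<phi> v) p)))"
    by (elim exE conjE)
  define \<rho> where "\<rho> k = 1 / real (Suc k)" for k
  have "\<forall>k. \<exists>C. finite C \<and> X \<subseteq> (\<Union>z\<in>C. cball z (\<rho> k))"
  proof
    fix k
    obtain C where "finite C" "X \<subseteq> (\<Union>z\<in>C. ball z (\<rho> k))" using cover[of "\<rho> k"] by (auto simp: \<rho>_def)
    moreover have "(\<Union>z\<in>C. ball z (\<rho> k)) \<subseteq> (\<Union>z\<in>C. cball z (\<rho> k))" by force
    ultimately show "\<exists>C. finite C \<and> X \<subseteq> (\<Union>z\<in>C. cball z (\<rho> k))" by blast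
  qed
  then obtain C where C: "\<And>k. finite (C k)" "\<And>k. X \<subseteq> (\<Union>z\<in>C k. cball z (\<rho> k))" by metis
  have "\<exists>p t a b z. strict_mono (a :: nat \<Rightarrow> nat) \<and> (\<forall>k. k \<le> b k) \<and>
      (\<forall>\<tau> :: nat \<Rightarrow> bool. \<exists>x\<in>X. (\<forall>k. if \<tau> k then dist (g (a k) x) p \<le> t else t + \<gamma> \<le> dist (g (a k) x) p) \<and>
        (\<forall>k. dist (g (b k) x) (z k) \<le> 1 / real (Suc k)))"
    if rich: "rich_models X g e c" and cont: "\<And>i. continuous_on X (g i)" for g
  proof -
    from pattern_realization_stage[where C=C and \<rho>=\<rho>, OF rich c C q indep]
    obtain M :: "nat \<Rightarrow> nat" where stage: "\<forall>N. \<forall>\<kappa>>0.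
      \<exists>D V E p t. D > 0 \<and> finite (V :: nat set) \<and> real (card V) \<le> D \<and> p \<in> P \<and> t \<in> Q \<and>
    (\<forall>i<N. q / 2 * D \<le> real (card (V \<inter> E i))) \<and>
    (\<forall>v\<in>V. \<exists>b z. (\<forall>k<N. b k \<in> {k..<k + M k} \<and> z k \<in> C k) \<and>
      patterns_realized X g p t \<gamma> \<rho> \<kappa> {i. i < N \<and> v \<in> E i} N b z)"
      by (elim exE)
    have "1 / real (Suc N) > 0" for N by simp
    then have "\<forall>N. \<exists>D V E p t. D > 0 \<and> finite (V :: nat set) \<and> real (card V) \<le> D \<and> p \<in> P \<and> t \<in> Q \<and>
    (\<forall>i<N. q / 2 * D \<le> real (card (V \<inter> E i))) \<and>
    (\<forall>v\<in>V. \<exists>b z. (\<forall>k<N. b k \<in> {k..<k + M k} \<and> z k \<in> C k) \<and>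
      patterns_realized X g p t \<gamma> \<rho> (1 / real (Suc N)) {i. i < N \<and> v \<in> E i} N b z)"
      using stage by blast
    from this[unfolded choice_iff]
    obtain D V E p t where all: "\<forall>N. D N > 0 \<and> finite (V N :: nat set) \<and> real (card (V N)) \<le> D N \<and> p N \<in> P \<and> t N \<in> Q \<and>
      (\<forall>i<N. q / 2 * D N \<le> real (card (V N \<inter> E N i))) \<and>
      (\<forall>v\<in>V N. \<exists>b z. (\<forall>k<N. b k \<in> {k..<k + M k} \<and> z k \<in> C k) \<and>
        patterns_realized X g (p N) (t N) \<gamma> \<rho> (1 / real (Suc N)) {i. i < N \<and> v \<in> E N i} N b z)"
      by (elim exE)
    have D: "D N > 0" and V: "finite (V N)" "real (card (V N)) \<le> D N" and pt: "p N \<in> P" "t N \<in> Q" for N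
      using all by simp_all
    have E: "q / 2 * D N \<le> real (card (V N \<inter> E N i))" if "i < N" for N i using all that by simp
    have pts: "\<exists>b z. (\<forall>k<N. b k \<in> {k..<k + M k} \<and> z k \<in> C k) \<and>
        patterns_realized X g (p N) (t N) \<gamma> \<rho> (1 / real (Suc N)) {i. i < N \<and> v \<in> E N i} N b z"
      if "v \<in> V N" for N v using all that by simp
    \<comment> \<open>Times beyond the stage are discarded, so that a visit always happens at a time below \<open>N\<close>.\<close>
    define E' where "E' N i = (if i < N then E N i else {})" for N i
    have "q / 2 > 0" using q by simp
    then have "\<exists>m :: nat \<Rightarrow> nat. strict_mono m \<and>
      (\<forall>K. \<exists>N\<ge>K. \<exists>v\<in>V N. \<forall>k<K. \<exists>i\<in>{m k..<m (Suc k)}. v \<in> E' N i)"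
      using D V E by (intro recurrent_windows[where D=D and q="q / 2"]) (simp_all add: E'_def)
    then obtain m where m: "strict_mono m"
      "\<And>K. \<exists>N\<ge>K. \<exists>v\<in>V N. \<forall>k<K. \<exists>i\<in>{m k..<m (Suc k)}. v \<in> E' N i"
      by blast
    from m(2) obtain NK vK where NK: "\<And>K. K \<le> NK K" "\<And>K. vK K \<in> V (NK K)"
      and hit: "\<And>K k. k < K \<Longrightarrow> \<exists>i\<in>{m k..<m (Suc k)}. vK K \<in> E' (NK K) i" by metis
    have "\<forall>K k. \<exists>i. k < K \<longrightarrow> i \<in> {m k..<m (Suc k)} \<and> vK K \<in> E' (NK K) i" using hit by blast
    then obtain a where a: "\<And>K k. k < K \<Longrightarrow> a K k \<in> {m k..<m (Suc k)} \<and> vK K \<in> E' (NK K) (a K k)" by metis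
    have "\<forall>K. \<exists>b z. (\<forall>k<NK K. b k \<in> {k..<k + M k} \<and> z k \<in> C k) \<and>
        patterns_realized X g (p (NK K)) (t (NK K)) \<gamma> \<rho> (1 / real (Suc (NK K))) {i. i < NK K \<and> vK K \<in> E (NK K) i} (NK K) b z"
      using pts NK(2) by simp
    from this[unfolded choice_iff] obtain b z where bz: "\<forall>K. (\<forall>k<NK K. b K k \<in> {k..<k + M k} \<and> z K k \<in> C k) \<and>
        patterns_realized X g (p (NK K)) (t (NK K)) \<gamma> \<rho> (1 / real (Suc (NK K))) {i. i < NK K \<and> vK K \<in> E (NK K) i} (NK K) (b K) (z K)"
      by (elim exE)
    have bz1: "b K k \<in> {k..<k + M k} \<and> z K k \<in> C k" if "k < NK K" for K k using bz that by simp
    have bz2: " patterns_realized X g (p (NK K)) (t (NK K)) \<gamma> \<rho> (1 / real (Suc (NK K))) {i. i < NK K \<and> vK K \<in> E (NK K) i} (NK K) (b K) (z K)" for K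
      using bz by simp
    have bzw: "b K k \<in> {k..<k + M k}" "z K k \<in> C k" if "k < K" for K k
      using bz1[of k K] NK(1)[of K] that by auto
    \<comment> \<open>The default value only serves to have total functions; a coordinate \<open>k\<close> is read at stages above \<open>k\<close>.\<close>
    define f where "f K k = (if k < K then (a K k, b K k, z K k, p (NK K), t (NK K)) else undefined)" for K k
    have "finite (range (\<lambda>K. f K k))" for k
    proof (rule finite_subset)
      show "range (\<lambda>K. f K k) \<subseteq> insert undefined ({m k..<m (Suc k)} \<times> {k..<k + M k} \<times> C k \<times> P \<times> Q)"
        unfolding f_def using a bzw pt by (intro image_subsetI) auto
      show "finite (insert undefined ({m k..<m (Suc k)} \<times> {k..<k + M k} \<times> C k \<times> P \<times> Q))"
        using C(1) P Q by simp
    qed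
    from finite_ranges_stabilizing_subseq[where f=f, OF this]
    obtain r G where r: "strict_mono r" and G': "\<forall>n. \<forall>N>n. f (r N) n = G n" by (elim exE conjE)
    have G: "f (r N) n = G n" if "N > n" for n N using G' that by blast
    have rN: "N \<le> r N" for N using seq_suble[OF r] .
    define a' where "a' k = fst (G k)" for k
    define b' where "b' k = fst (snd (G k))" for k
    define z' where "z' k = fst (snd (snd (G k)))" for k
    define p' where "p' = fst (snd (snd (snd (G 0))))"
    define t' where "t' = snd (snd (snd (snd (G 0))))"
    have eqs: "a (r N) k = a' k" "b (r N) k = b' k" "z (r N) k = z' k" if "N > k" for N k
      using G[OF that, symmetric] rN[of N] that by (simp_all add: f_def a'_def b'_def z'_def)
    have eqpt: "p (NK (r N)) = p'" "t (NK (r N)) = t'" if "N > 0" for N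
      using G[OF that, symmetric] rN[of N] that by (simp_all add: f_def p'_def t'_def)
    have aw: "a' k \<in> {m k..<m (Suc k)}" "k \<le> b' k" for k
      using a[of k "r (Suc k)"] bzw(1)[of k "r (Suc k)"] eqs[of k "Suc k"] rN[of "Suc k"] by auto
    have sa: "strict_mono a'"
      unfolding strict_mono_Suc_iff
    proof
      fix k show "a' k < a' (Suc k)" using aw(1)[of k] aw(1)[of "Suc k"] by auto
    qed
    have pattern: "\<exists>x\<in>X. (\<forall>k. if \<tau> k then dist (g (a' k) x) p' \<le> t' else t' + \<gamma> \<le> dist (g (a' k) x) p') \<and>
        (\<forall>k. dist (g (b' k) x) (z' k) \<le> 1 / real (Suc k))" for \<tau> :: "nat \<Rightarrow> bool"
    proof -
      define PP where "PP K x \<longleftrightarrow> (\<forall>k<K. if \<tau> k then dist (g (a' k) x) p' \<le> t' + 1 / real (Suc K)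
            else t' + \<gamma> - 1 / real (Suc K) \<le> dist (g (a' k) x) p') \<and>
          (\<forall>k<K. dist (g (b' k) x) (z' k) \<le> \<rho> k + 1 / real (Suc K))" for K x
      have approx: "\<exists>x\<in>X. PP K x" if K: "K > 0" for K
      proof -
        define N where "N = NK (r K)"
        have KN: "K \<le> N" using NK(1)[of "r K"] rN[of K] by (simp add: N_def)
        have kap: "1 / real (Suc N) \<le> 1 / real (Suc K)" using KN by (simp add: frac_le)
        have ain: "a' k < N \<and> vK (r K) \<in> E N (a' k)" if k: "k < K" for k
        proof -
          have "vK (r K) \<in> E' N (a' k)" using a[of k "r K"] k rN[of K] eqs(1)[OF k] by (simp add: N_def)
          then show ?thesis by (simp add: E'_def split: if_splits)
        qed
        have ptK: "p N = p'" "t N = t'" using eqpt[OF K] by (simp_all add: N_def)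
        define U where "U = a' ` {k. k < K \<and> \<tau> k}"
        have "U \<subseteq> {i. i < N \<and> vK (r K) \<in> E N i}" using ain by (auto simp: U_def)
        with bz2[of "r K"] obtain x where x: "x \<in> X" "\<forall>i\<in>U. dist (g i x) p' \<le> t' + 1 / real (Suc N)"
          "\<forall>i\<in>{i. i < N \<and> vK (r K) \<in> E N i} - U. t' + \<gamma> - 1 / real (Suc N) \<le> dist (g i x) p'"
          "\<forall>k<N. dist (g (b (r K) k) x) (z (r K) k) \<le> \<rho> k + 1 / real (Suc N)"
          unfolding patterns_realized_def N_def[symmetric] ptK by blast
        have "dist (g (a' k) x) p' \<le> t' + 1 / real (Suc K)" if "k < K" "\<tau> k" for k
        proof -
          have "a' k \<in> U" using that by (auto simp: U_def)
          with x(2) kap show ?thesis by force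
        qed
        moreover have "t' + \<gamma> - 1 / real (Suc K) \<le> dist (g (a' k) x) p'" if "k < K" "\<not> \<tau> k" for k
        proof -
          have "a' k \<notin> U" using that strict_mono_eq[OF sa] by (auto simp: U_def)
          then show ?thesis using bspec[OF x(3), of "a' k"] ain[OF that(1)] kap by simp
        qed
        moreover have "dist (g (b' k) x) (z' k) \<le> \<rho> k + 1 / real (Suc K)" if "k < K" for k
          using x(4)[rule_format, of k] eqs(2,3)[OF that] that KN kap by simp
        ultimately have "PP K x" unfolding PP_def by simp
        then show ?thesis using x(1) by blast
      qed
      have "\<exists>x. x \<in> X \<and> PP K x" for K
      proof (cases "K = 0")
        case True
        obtain x where "x \<in> X" using approx[of 1] by auto
        moreover have "PP K x" using True by (simp add: PP_def)
        ultimately show ?thesis by blast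
      next
        case False
        then show ?thesis using approx[of K] by blast
      qed
      then obtain xs where xs': "\<And>K. xs K \<in> X \<and> PP K (xs K)" by metis
      have xs: "xs K \<in> X" for K using xs' by blast
      have xs1: "if \<tau> k then dist (g (a' k) (xs K)) p' \<le> t' + 1 / real (Suc K)
            else t' + \<gamma> - 1 / real (Suc K) \<le> dist (g (a' k) (xs K)) p'" if "k < K" for K k
        using xs'[of K] that unfolding PP_def by blast
      have xs2: "dist (g (b' k) (xs K)) (z' k) \<le> \<rho> k + 1 / real (Suc K)" if "k < K" for K k
        using xs'[of K] that unfolding PP_def by blast
      obtain x s where x: "x \<in> X" and s: "strict_mono s" "(xs \<circ> s) \<longlonglongrightarrow> x"
        using X xs unfolding compact_def by blast
      have cd: "continuous_on X (\<lambda>x. dist (g i x) y)" for i y by (intro continuous_intros cont)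
      have lim1: "if \<tau> k then dist (g (a' k) x) p' \<le> t' else t' + \<gamma> \<le> dist (g (a' k) x) p'" for k
      proof (cases "\<tau> k")
        case True
        have "dist (g (a' k) x) p' \<le> t'"
        proof (rule le_of_subseq_limit[where xs=xs and s=s and k=k, OF cd xs x s])
          fix K assume "k < K"
          from xs1[OF this] True show "dist (g (a' k) (xs K)) p' \<le> t' + 1 / real (Suc K)" by simp
        qed
        with True show ?thesis by simp
      next
        case False
        have neg: "continuous_on X (\<lambda>x. - dist (g (a' k) x) p')" by (intro continuous_on_minus cd)
        have "- dist (g (a' k) x) p' \<le> - (t' + \<gamma>)"
        proof (rule le_of_subseq_limit[where xs=xs and s=s and k=k, OF neg xs x s])
          fix K assume "k < K"
          from xs1[OF this] False show "- dist (g (a' k) (xs K)) p' \<le> - (t' + \<gamma>) + 1 / real (Suc K)" by simp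
        qed
        with False show ?thesis by simp
      qed
      have lim2: "dist (g (b' k) x) (z' k) \<le> 1 / real (Suc k)" for k
      proof (rule le_of_subseq_limit[where xs=xs and s=s and k=k, OF cd xs x s])
        fix K assume "k < K"
        from xs2[OF this] show "dist (g (b' k) (xs K)) (z' k) \<le> 1 / real (Suc k) + 1 / real (Suc K)"
          by (simp only: \<rho>_def)
      qed
      show ?thesis by (rule bexI[OF _ x], intro conjI allI lim1 lim2)
    qed
    show ?thesis
      by (rule exI[of _ p'], rule exI[of _ t'], rule exI[of _ a'], rule exI[of _ b'], rule exI[of _ z'],
          intro conjI allI sa aw(2) pattern)
  qed
  then show ?thesis using gam by blast
qed

section \<open>Cantor sets in compact sets that code 0-1-sequences\<close>

lemma cantor_stage_bounds: "x \<in> cantor_stage n \<Longrightarrow> 0 \<le> x \<and> x \<le> 1"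
  by (induction n arbitrary: x) force+

lemma compact_cantor_stage: "compact (cantor_stage n)"
proof (induction n)
  case (Suc n)
  have "compact ((\<lambda>x. x / 3) ` cantor_stage n)" "compact ((\<lambda>x. 2 / 3 + x / 3) ` cantor_stage n)"
    using Suc by (auto intro!: compact_continuous_image continuous_intros)
  then show ?case by (simp add: compact_Un)
qed simp

lemma compact_standard_cantor_set: "compact standard_cantor_set"
proof -
  have "standard_cantor_set = cantor_stage 0 \<inter> (\<Inter>n. cantor_stage n)"
    unfolding standard_cantor_set_def by blast
  moreover have "closed (\<Inter>n. cantor_stage n)"
    by (intro closed_INT) (auto intro: compact_imp_closed compact_cantor_stage)
  ultimately show ?thesis using compact_cantor_stage[of 0] by (metis compact_Int_closed)
qed

definition ternary_shift :: "real \<Rightarrow> real" where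
  "ternary_shift x = (if x \<le> 1/2 then 3 * x else 3 * x - 2)"

text \<open>
The \<open>n\<close>-th ternary digit of a point of the standard Cantor set, with \<open>True\<close> for the digit 2.  The value \<open>1/2\<close>, as any other
in the middle third, separates the two thirds that meet the set.
\<close>
definition ternary_digit :: "real \<Rightarrow> nat \<Rightarrow> bool" where
  "ternary_digit x n \<longleftrightarrow> (ternary_shift ^^ n) x > 1/2"

lemma standard_cantor_set_cases:
  assumes "x \<in> standard_cantor_set"
  shows "0 \<le> x \<and> x \<le> 1/3 \<or> 2/3 \<le> x \<and> x \<le> 1"
proof -
  have "x \<in> cantor_stage (Suc 0)" using assms unfolding standard_cantor_set_def by blast
  then show ?thesis by auto
qed

lemma ternary_shift_in:
  assumes "x \<in> standard_cantor_set"
  shows "ternary_shift x \<in> standard_cantor_set"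
proof -
  have "ternary_shift x \<in> cantor_stage n" for n
  proof -
    have "x \<in> cantor_stage (Suc n)" using assms unfolding standard_cantor_set_def by blast
    then obtain y where y: "y \<in> cantor_stage n" "x = y / 3 \<or> x = 2/3 + y / 3" by auto
    then have "ternary_shift x = y"
      using cantor_stage_bounds[OF y(1)] by (auto simp: ternary_shift_def)
    with y show ?thesis by simp
  qed
  then show ?thesis by (simp add: standard_cantor_set_def)
qed

lemma ternary_shift_funpow_in:
  "x \<in> standard_cantor_set \<Longrightarrow> (ternary_shift ^^ n) x \<in> standard_cantor_set"
  by (induction n) (auto intro: ternary_shift_in)

lemma ternary_shift_expands:
  assumes "\<And>i. i < n \<Longrightarrow> ternary_digit x i = ternary_digit y i"
  shows "\<bar>(ternary_shift ^^ n) x - (ternary_shift ^^ n) y\<bar> = 3 ^ n * \<bar>x - y\<bar>"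
  using assms
proof (induction n)
  case (Suc n)
  let ?x = "(ternary_shift ^^ n) x" and ?y = "(ternary_shift ^^ n) y"
  have "ternary_digit x n = ternary_digit y n" using Suc.prems by simp
  then have "ternary_shift ?x - ternary_shift ?y = 3 * (?x - ?y)"
    by (auto simp: ternary_digit_def ternary_shift_def)
  then have "\<bar>ternary_shift ?x - ternary_shift ?y\<bar> = \<bar>3\<bar> * \<bar>?x - ?y\<bar>" by (simp only: abs_mult)
  also have "\<dots> = \<bar>3\<bar> * (3 ^ n * \<bar>x - y\<bar>)" using Suc by simp
  finally show ?case by simp
qed simp

text \<open>
The shift triples distances as long as the digits agree, and two points on different sides of
the removed middle third are at least \<open>1/3\<close> apart.
\<close>
lemma ternary_digits_near:
  assumes "x \<in> standard_cantor_set" "y \<in> standard_cantor_set" "3 ^ n * \<bar>x - y\<bar> < 1" "i < n"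
  shows "ternary_digit x i = ternary_digit y i"
  using assms(4)
proof (induction i rule: less_induct)
  case (less i)
  let ?x = "(ternary_shift ^^ i) x" and ?y = "(ternary_shift ^^ i) y"
  have "3 * \<bar>?x - ?y\<bar> = 3 ^ Suc i * \<bar>x - y\<bar>"
    using ternary_shift_expands[of i x y] less by simp
  also have "\<dots> \<le> 3 ^ n * \<bar>x - y\<bar>"
    using less.prems by (intro mult_right_mono power_increasing) auto
  finally have "3 * \<bar>?x - ?y\<bar> < 1" using assms(3) by simp
  with standard_cantor_set_cases[OF ternary_shift_funpow_in[OF assms(1), of i]]
    standard_cantor_set_cases[OF ternary_shift_funpow_in[OF assms(2), of i]]
  show ?case by (auto simp: ternary_digit_def)
qed

lemma ternary_digit_inj: "inj_on ternary_digit standard_cantor_set"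
proof (rule inj_onI)
  fix x y assume xy: "x \<in> standard_cantor_set" "y \<in> standard_cantor_set" "ternary_digit x = ternary_digit y"
  show "x = y"
  proof (rule ccontr)
    assume "x \<noteq> y"
    then obtain n where n: "1 / \<bar>x - y\<bar> < 3 ^ n" using real_arch_pow[of 3 "1 / \<bar>x - y\<bar>"] by auto
    then have "1 < 3 ^ n * \<bar>x - y\<bar>" using \<open>x \<noteq> y\<close> by (simp add: pos_divide_less_eq)
    also have "\<dots> = \<bar>(ternary_shift ^^ n) x - (ternary_shift ^^ n) y\<bar>"
      using ternary_shift_expands[of n x y] xy by simp
    also have "\<dots> \<le> 1"
      using standard_cantor_set_cases[OF ternary_shift_funpow_in[OF xy(1), of n]]
        standard_cantor_set_cases[OF ternary_shift_funpow_in[OF xy(2), of n]] by auto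
    finally show False by simp
  qed
qed

text \<open>
Reading off ternary digits turns \<open>g\<close> into a continuous injection of the standard Cantor set.
\<close>
lemma cantor_set_from_scheme:
  fixes g :: "(nat \<Rightarrow> bool) \<Rightarrow> 'x::metric_space"
  assumes inj: "inj g"
    and cont: "\<And>k \<tau> \<tau>'. (\<And>i. i \<le> k \<Longrightarrow> \<tau> i = \<tau>' i) \<Longrightarrow> dist (g \<tau>) (g \<tau>') \<le> 1 / real (Suc k)"
  shows "\<exists>K\<subseteq>range g. is_cantor_set K"
proof -
  define f where "f x = g (ternary_digit x)" for x
  have "continuous_on standard_cantor_set f"
    unfolding continuous_on_iff
  proof (intro ballI allI impI)
    fix x and e :: real assume x: "x \<in> standard_cantor_set" and "e > 0"
    then obtain k where k: "1 / real (Suc k) < e" using nat_approx_posE by blast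
    show "\<exists>d>0. \<forall>x'\<in>standard_cantor_set. dist x' x < d \<longrightarrow> dist (f x') (f x) < e"
    proof (intro exI conjI ballI impI)
      show "(0::real) < 1 / 3 ^ Suc k" by simp
      fix x' assume x': "x' \<in> standard_cantor_set" "dist x' x < 1 / 3 ^ Suc k"
      then have "3 ^ Suc k * \<bar>x' - x\<bar> < 1" by (simp add: dist_real_def field_simps)
      then have "dist (f x') (f x) \<le> 1 / real (Suc k)"
        unfolding f_def using ternary_digits_near[OF x'(1) x, of "Suc k"] by (intro cont) auto
      with k show "dist (f x') (f x) < e" by simp
    qed
  qed
  moreover have "inj_on f standard_cantor_set"
    using ternary_digit_inj inj unfolding f_def inj_on_def by blast
  ultimately have "standard_cantor_set homeomorphic (f ` standard_cantor_set)"
    using compact_standard_cantor_set by (meson homeomorphic_compact)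
  then have "is_cantor_set (f ` standard_cantor_set)"
    unfolding is_cantor_set_def by (rule homeomorphic_sym[THEN iffD1])
  moreover have "f ` standard_cantor_set \<subseteq> range g" by (auto simp: f_def)
  ultimately show ?thesis by blast
qed

lemma compact_decreasing_Inter_nonempty:
  fixes F :: "nat \<Rightarrow> 'x::t2_space set"
  assumes F: "\<And>n. compact (F n)" "\<And>n. F n \<noteq> {}" and mono: "\<And>m n. m \<le> n \<Longrightarrow> F n \<subseteq> F m"
  shows "(\<Inter>n. F n) \<noteq> {}"
proof -
  have "F 0 \<inter> (\<Inter>n\<in>UNIV. F n) \<noteq> {}"
  proof (rule compact_imp_fip_image)
    fix I :: "nat set" assume "finite I"
    then have "F (Max (insert 0 I)) \<subseteq> F 0 \<inter> (\<Inter>n\<in>I. F n)"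
      by (intro Int_greatest INT_greatest mono) auto
    with F(2)[of "Max (insert 0 I)"] show "F 0 \<inter> (\<Inter>n\<in>I. F n) \<noteq> {}" by blast
  qed (use F in \<open>auto intro: compact_imp_closed\<close>)
  then show ?thesis by blast
qed

definition cylinder :: "(nat \<Rightarrow> bool) \<Rightarrow> nat \<Rightarrow> (nat \<Rightarrow> bool) set" where
  "cylinder \<tau> n = {\<sigma>. \<forall>i<n. \<sigma> i = \<tau> i}"

text \<open>
Continuity of a map into the space of 0-1-sequences, expressed without a topology on that space.
\<close>
definition coding_on :: "'x::topological_space set \<Rightarrow> ('x \<Rightarrow> nat \<Rightarrow> bool) \<Rightarrow> bool" where
  "coding_on C \<pi> \<longleftrightarrow> (\<forall>i b. closed {x \<in> C. \<pi> x i = b})"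

lemma compact_restrict_code:
  fixes S :: "'x::metric_space set"
  assumes "coding_on C \<pi>" "compact S" "S \<subseteq> C"
  shows "compact {x \<in> S. \<forall>i<m. \<pi> x i = \<sigma> i}"
proof -
  have "{x \<in> S. \<forall>i<m. \<pi> x i = \<sigma> i} = S \<inter> (\<Inter>i\<in>{..<m}. {x \<in> C. \<pi> x i = \<sigma> i})"
    using assms(3) by auto
  moreover have "closed (\<Inter>i\<in>{..<m}. {x \<in> C. \<pi> x i = \<sigma> i})"
    using assms(1) by (intro closed_INT) (auto simp: coding_on_def)
  ultimately show ?thesis using assms(2) by (simp add: compact_Int_closed)
qed

text \<open>
If every cylinder around \<open>\<sigma>\<close> met the image, the points of \<open>S\<close> with codes in these cylinders would form a decreasing sequence
of nonempty compact sets, and a common point would have the code \<open>\<sigma>\<close>.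
\<close>
lemma code_image_closed:
  fixes S :: "'x::metric_space set"
  assumes c: "coding_on C \<pi>" "compact S" "S \<subseteq> C" and "\<sigma> \<notin> \<pi> ` S"
  shows "\<exists>m. cylinder \<sigma> m \<inter> \<pi> ` S = {}"
proof (rule ccontr)
  assume "\<not> ?thesis"
  then have ne: "{x \<in> S. \<forall>i<m. \<pi> x i = \<sigma> i} \<noteq> {}" for m
    by (auto simp: cylinder_def)
  have "(\<Inter>m. {x \<in> S. \<forall>i<m. \<pi> x i = \<sigma> i}) \<noteq> {}"
    by (rule compact_decreasing_Inter_nonempty) (use ne compact_restrict_code[OF c] in auto)
  then obtain x where "x \<in> S" "\<And>m i. i < m \<Longrightarrow> \<pi> x i = \<sigma> i" by auto
  then have "\<pi> x = \<sigma>" by blast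
  with \<open>x \<in> S\<close> assms(4) show False by blast
qed

text \<open>
Baire's theorem for finitely many closed sets: if the images of finitely many small pieces
of \<open>S\<close> cover a cylinder, one of them contains a cylinder, because otherwise the images could be avoided one after the
other by shrinking the cylinder.
\<close>
lemma cylinder_small_piece:
  fixes S :: "'x::metric_space set"
  assumes c: "coding_on C \<pi>" "compact S" "S \<subseteq> C" and cyl: "cylinder \<tau> n \<subseteq> \<pi> ` S" and "e > 0"
  shows "\<exists>S' \<tau>' n'. S' \<subseteq> S \<and> compact S' \<and> (\<forall>x\<in>S'. \<forall>y\<in>S'. dist x y \<le> e) \<and> cylinder \<tau>' n' \<subseteq> \<pi> ` S'"
proof (rule ccontr)
  assume neg: "\<not> ?thesis"
  define piece where "piece p = S \<inter> cball p (e/2)" for p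
  have no: "\<not> cylinder \<tau>' n' \<subseteq> \<pi> ` piece p" for p \<tau>' n'
  proof
    assume A: "cylinder \<tau>' n' \<subseteq> \<pi> ` piece p"
    have "dist x y \<le> e" if "x \<in> piece p" "y \<in> piece p" for x y
    proof -
      have "dist p x \<le> e/2" "dist p y \<le> e/2" using that by (auto simp: piece_def)
      then show ?thesis using dist_triangle3[of x y p] by linarith
    qed
    moreover have "compact (piece p)" using c by (simp add: piece_def compact_Int_closed)
    ultimately show False using neg A by (auto simp: piece_def)
  qed
  obtain P where P: "finite P" "S \<subseteq> (\<Union>p\<in>P. ball p (e/2))"
    using compactE_image[OF c(2), of S "\<lambda>p. ball p (e/2)"] \<open>e > 0\<close> by (metis (no_types, lifting) UN_I centre_in_ball half_gt_zero open_ball subsetI)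
  have "\<exists>\<tau>' n'. n \<le> n' \<and> cylinder \<tau>' n' \<subseteq> cylinder \<tau> n \<and> (\<forall>p\<in>P. cylinder \<tau>' n' \<inter> \<pi> ` piece p = {})"
    using P(1)
  proof (induction P rule: finite_induct)
    case empty
    then show ?case by blast
  next
    case (insert p P)
    then obtain \<tau>' n' where I: "n \<le> n'" "cylinder \<tau>' n' \<subseteq> cylinder \<tau> n" "\<forall>p\<in>P. cylinder \<tau>' n' \<inter> \<pi> ` piece p = {}"
      by blast
    obtain \<sigma> where s: "\<sigma> \<in> cylinder \<tau>' n'" "\<sigma> \<notin> \<pi> ` piece p" using no by blast
    obtain m where m: "cylinder \<sigma> m \<inter> \<pi> ` piece p = {}"
      using code_image_closed[OF c(1) _ _ s(2)] c by (auto simp: piece_def compact_Int_closed)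
    have "cylinder \<sigma> (max m n') \<subseteq> cylinder \<sigma> m" "cylinder \<sigma> (max m n') \<subseteq> cylinder \<tau>' n'"
      using s(1) by (auto simp: cylinder_def)
    with m I(2,3) have "cylinder \<sigma> (max m n') \<subseteq> cylinder \<tau> n"
      "\<forall>q\<in>insert p P. cylinder \<sigma> (max m n') \<inter> \<pi> ` piece q = {}" by blast+
    with I(1) show ?case by (metis max.coboundedI2)
  qed
  then obtain \<tau>' n' where f: "cylinder \<tau>' n' \<subseteq> cylinder \<tau> n" "\<And>p. p\<in>P \<Longrightarrow> cylinder \<tau>' n' \<inter> \<pi> ` piece p = {}"
    by blast
  have "\<tau>' \<in> cylinder \<tau>' n'" by (simp add: cylinder_def)
  with f(1) cyl obtain x where x: "x \<in> S" "\<pi> x = \<tau>'" by blast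
  with P obtain p where "p \<in> P" "x \<in> ball p (e/2)" by blast
  with x have "x \<in> piece p" by (auto simp: piece_def)
  with f(2)[OF \<open>p \<in> P\<close>] x \<open>\<tau>' \<in> cylinder \<tau>' n'\<close> show False by blast
qed

text \<open>
A Cantor scheme of compact subsets of \<open>C\<close>, each of which is mapped onto some cylinder.  A node given by \<open>(S, \<tau>, n)\<close> with
\<open>cylinder \<tau> n \<subseteq> \<pi> ` S\<close> is split according to the digit \<open>\<pi> x n\<close>, which the cylinder leaves free; then both parts are cut down to small
pieces.  Different branches are separated by a digit of \<open>\<pi>\<close>, so \<open>\<pi>\<close> is injective on the limit points.
\<close>
theorem cantor_set_of_codes:
  fixes C :: "'x::metric_space set"
  assumes C: "compact C" and coding: "coding_on C \<pi>" and onto: "\<pi> ` C = UNIV"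
  shows "\<exists>K\<subseteq>C. is_cantor_set K \<and> inj_on \<pi> K"
proof -
  define good where "good = (\<lambda>(S, \<tau>::nat \<Rightarrow> bool, n). compact S \<and> S \<subseteq> C \<and> cylinder \<tau> n \<subseteq> \<pi> ` S)"
  define small where "small k S \<longleftrightarrow> (\<forall>x\<in>S. \<forall>y\<in>S. dist x y \<le> 1 / real (Suc k))" for k :: nat and S :: "'x set"
  have "\<exists>q. good q \<and> fst q \<subseteq> fst p \<and> small k (fst q) \<and> (\<forall>x\<in>fst q. \<pi> x (snd (snd p)) = b)"
    if "good p" for p k b
  proof -
    obtain S \<tau> n where p: "p = (S, \<tau>, n)" by (cases p)
    with that have g: "compact S" "S \<subseteq> C" "cylinder \<tau> n \<subseteq> \<pi> ` S" by (auto simp: good_def)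
    define T where "T = {x \<in> S. \<forall>i<Suc n. \<pi> x i = (\<tau>(n := b)) i}"
    have T: "compact T" "T \<subseteq> C" using compact_restrict_code[OF coding g(1,2)] g by (auto simp: T_def)
    have "cylinder (\<tau>(n := b)) (Suc n) \<subseteq> \<pi> ` T"
    proof
      fix \<sigma> assume s: "\<sigma> \<in> cylinder (\<tau>(n := b)) (Suc n)"
      then have "\<sigma> \<in> cylinder \<tau> n" by (auto simp: cylinder_def)
      with g obtain x where "x \<in> S" "\<pi> x = \<sigma>" by blast
      with s show "\<sigma> \<in> \<pi> ` T" by (auto simp: T_def cylinder_def)
    qed
    from cylinder_small_piece[OF coding T this, of "1 / real (Suc k)"]
    obtain S' \<tau>' n' where "S' \<subseteq> T" "compact S'" "small k S'" "cylinder \<tau>' n' \<subseteq> \<pi> ` S'"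
      by (auto simp: small_def)
    then show ?thesis using T p
      by (intro exI[of _ "(S', \<tau>', n')"]) (auto simp: good_def T_def)
  qed
  then obtain nxt where nxt: "\<And>p k b. good p \<Longrightarrow> good (nxt p k b) \<and> fst (nxt p k b) \<subseteq> fst p \<and>
      small k (fst (nxt p k b)) \<and> (\<forall>x\<in>fst (nxt p k b). \<pi> x (snd (snd p)) = b)"
    by metis
  define node where "node \<omega> = rec_nat (C, \<lambda>_. False, 0) (\<lambda>k p. nxt p k (\<omega> k))" for \<omega>
  have node0: "node \<omega> 0 = (C, \<lambda>_. False, 0)" and nodeS: "node \<omega> (Suc k) = nxt (node \<omega> k) k (\<omega> k)" for \<omega> k
    by (simp_all add: node_def)
  have good: "good (node \<omega> k)" for \<omega> k
    by (induction k) (use nxt C onto in \<open>auto simp: node0 nodeS good_def\<close>)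
  have cong: "node \<omega> k = node \<omega>' k" if "\<And>i. i < k \<Longrightarrow> \<omega> i = \<omega>' i" for \<omega> \<omega>' k
    using that by (induction k) (auto simp: node0 nodeS)
  have ne: "fst (node \<omega> k) \<noteq> {}" for \<omega> k
  proof -
    obtain S \<tau> n where p: "node \<omega> k = (S, \<tau>, n)" by (cases "node \<omega> k")
    have "\<tau> \<in> cylinder \<tau> n" by (simp add: cylinder_def)
    with good[of \<omega> k] p show ?thesis by (auto simp: good_def)
  qed
  have mono: "fst (node \<omega> n) \<subseteq> fst (node \<omega> m)" if "m \<le> n" for \<omega> m n
    using that by (induction rule: dec_induct) (simp, metis nxt good nodeS subset_trans)
  have "\<exists>x. \<forall>k. x \<in> fst (node \<omega> k)" for \<omega>
  proof -
    have "(\<Inter>k. fst (node \<omega> k)) \<noteq> {}"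
    proof (rule compact_decreasing_Inter_nonempty)
      show "compact (fst (node \<omega> k))" for k using good[of \<omega> k] by (auto simp: good_def case_prod_beta)
    qed (use ne mono in auto)
    then show ?thesis by auto
  qed
  then obtain g where g: "\<And>\<omega> k. g \<omega> \<in> fst (node \<omega> k)" by metis
  have neq: "\<pi> (g \<omega>) \<noteq> \<pi> (g \<omega>')" if "\<omega> \<noteq> \<omega>'" for \<omega> \<omega>'
  proof -
    define k where "k = (LEAST k. \<omega> k \<noteq> \<omega>' k)"
    from that have "\<exists>k. \<omega> k \<noteq> \<omega>' k" by blast
    then have k: "\<omega> k \<noteq> \<omega>' k" unfolding k_def by (rule LeastI_ex)
    have k': "\<omega> i = \<omega>' i" if "i < k" for i
      using not_less_Least[of i "\<lambda>k. \<omega> k \<noteq> \<omega>' k"] that unfolding k_def by blast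
    have "node \<omega> k = node \<omega>' k" using k' by (intro cong) auto
    moreover have d: "\<pi> (g \<omega>) (snd (snd (node \<omega> k))) = \<omega> k" for \<omega>
    proof -
      have "\<forall>x\<in>fst (node \<omega> (Suc k)). \<pi> x (snd (snd (node \<omega> k))) = \<omega> k"
        using nxt[OF good[of \<omega> k], of k "\<omega> k"] unfolding nodeS by blast
      with g show ?thesis by blast
    qed
    ultimately show ?thesis using k d[of \<omega>] d[of \<omega>'] by fastforce
  qed
  have "inj g" using neq by (metis injI)
  moreover have "dist (g \<tau>) (g \<tau>') \<le> 1 / real (Suc k)" if "\<And>i. i \<le> k \<Longrightarrow> \<tau> i = \<tau>' i" for k \<tau> \<tau>'
  proof -
    have "small k (fst (node \<tau> (Suc k)))" using nxt[OF good[of \<tau> k]] by (auto simp: nodeS)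
    moreover have "node \<tau> (Suc k) = node \<tau>' (Suc k)" using that by (intro cong) auto
    ultimately show ?thesis using g[of \<tau> "Suc k"] g[of \<tau>' "Suc k"] by (simp add: small_def)
  qed
  ultimately obtain K where K: "K \<subseteq> range g" "is_cantor_set K"
    using cantor_set_from_scheme[of g] by blast
  have "inj_on \<pi> (range g)"
  proof (rule inj_onI)
    fix x y assume "x \<in> range g" "y \<in> range g" and eq: "\<pi> x = \<pi> y"
    then obtain \<omega> \<omega>' where "x = g \<omega>" "y = g \<omega>'" by blast
    with neq[of \<omega> \<omega>'] eq show "x = y" by metis
  qed
  moreover have "g \<omega> \<in> C" for \<omega> using g[of \<omega> 0] by (simp add: node0)
  then have "range g \<subseteq> C" by blast
  ultimately show ?thesis using K by (meson inj_on_subset order_trans)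
qed

section \<open>Models from positive sofic entropy\<close>

lemma exists_large_separated_set:
  assumes d: "n > 0" and gt: "ereal c < ereal (1 / real n) * log_enat (separated_number r \<epsilon> A)" and c: "c > 0"
  shows "\<exists>S. finite S \<and> S \<subseteq> A \<and> pairwise (\<lambda>x y. \<epsilon> \<le> r x y) S \<and> exp (c * real n) \<le> real (card S)"
proof (rule ccontr)
  assume no: "\<not> ?thesis"
  define k where "k = nat \<lfloor>exp (c * real n)\<rfloor>"
  have k: "real k \<le> exp (c * real n)" by (simp add: k_def)
  have "separated_number r \<epsilon> A \<le> enat k"
    unfolding separated_number_def
  proof (rule SUP_least)
    fix S assume "S \<in> {S. finite S \<and> S \<subseteq> A \<and> pairwise (\<lambda>x y. \<epsilon> \<le> r x y) S}"
    then have "real (card S) < exp (c * real n)" using no by (auto simp: not_le)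
    then have "card S \<le> k" unfolding k_def by linarith
    then show "enat (card S) \<le> enat k" by simp
  qed
  then obtain j where j: "separated_number r \<epsilon> A = enat j" "j \<le> k"
    by (metis enat_ile enat_ord_simps(1))
  have "ereal (1 / real n) * log_enat (enat j) \<le> ereal c"
  proof (cases "j = 0")
    case True
    have "ereal (1 / real n) * - \<infinity> = - \<infinity>" using d by simp
    with True show ?thesis by (simp add: log_enat_def)
  next
    case False
    have "real j \<le> exp (c * real n)" using j(2) k by linarith
    then have "ln (real j) \<le> ln (exp (c * real n))" using False by (subst ln_le_cancel_iff) auto
    then have "ln (real j) \<le> c * real n" by simp
    then have "1 / real n * ln (real j) \<le> c" using d by (simp add: field_simps)
    with False show ?thesis by (simp add: log_enat_def)
  qed
  with gt j show False by simp
qed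

text \<open>
Chebyshev's inequality.
\<close>
lemma card_exceeding_le:
  assumes n: "n > 0" and rho: "rho_2 n \<phi> \<psi> < \<eta>" and k: "\<kappa> > 0"
  shows "real (card {v\<in>{1..n}. \<kappa> < dist (\<phi> v) (\<psi> v)}) \<le> \<eta>\<^sup>2 / \<kappa>\<^sup>2 * real n"
proof -
  let ?A = "{v\<in>{1..n}. \<kappa> < dist (\<phi> v) (\<psi> v)}"
  let ?s = "(\<Sum>v=1..n. (dist (\<phi> v) (\<psi> v))\<^sup>2)"
  have s0: "0 \<le> ?s" by (intro sum_nonneg) auto
  have "sqrt (?s / real n) < \<eta>" using rho by (simp add: rho_2_def)
  moreover have "0 \<le> sqrt (?s / real n)" using s0 by simp
  ultimately have "(sqrt (?s / real n))\<^sup>2 \<le> \<eta>\<^sup>2" by (intro power_mono) auto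
  then have "?s / real n \<le> \<eta>\<^sup>2" using s0 by simp
  then have s: "?s \<le> \<eta>\<^sup>2 * real n" using n by (simp add: pos_divide_le_eq)
  have "real (card ?A) * \<kappa>\<^sup>2 = (\<Sum>v\<in>?A. \<kappa>\<^sup>2)" by simp
  also have "\<dots> \<le> (\<Sum>v\<in>?A. (dist (\<phi> v) (\<psi> v))\<^sup>2)" using k by (intro sum_mono power_mono) auto
  also have "\<dots> \<le> ?s" by (intro sum_mono2) auto
  finally have "real (card ?A) * \<kappa>\<^sup>2 \<le> \<eta>\<^sup>2 * real n" using s by linarith
  then show ?thesis using k by (simp add: field_simps)
qed

text \<open>
The scale \<open>e\<close> and the rate \<open>c\<close> are read off from the entropy and serve all sequences \<open>s\<close>, because the entropy takes the
infimum over all finite sets \<open>F\<close>.  The exponential growth holds for infinitely many \<open>j\<close>, and the required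
properties of the sofic approximation hold for almost all \<open>j\<close>, so some \<open>j\<close> has both.
\<close>
lemma rich_models_of_entropy:
  fixes X :: "'x::metric_space set"
  assumes sofic: "sofic_approximation G d \<sigma>" and ent: "sofic_top_entropy G d \<sigma> X act > 0"
  shows "\<exists>e>0. \<exists>c>0. \<forall>s :: nat \<Rightarrow> 'g. inj s \<and> range s \<subseteq> carrier G \<longrightarrow> rich_models X (\<lambda>i. act (s i)) e c"
proof -
  let ?h = "\<lambda>\<epsilon> F \<eta> j. ereal (1 / real (d j)) *
          log_enat (separated_number (rho_inf (d j)) \<epsilon> (sofic_Map X act F \<eta> (d j) (\<sigma> j)))"
  let ?F = "{F. finite F \<and> F \<noteq> {} \<and> F \<subseteq> carrier G}"
  obtain e where e: "e > 0" and ent': "0 < (INF F \<in> ?F. INF \<eta> \<in> {0<..}. limsup (?h e F \<eta>))"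
    using ent unfolding sofic_top_entropy_def less_SUP_iff by auto
  then obtain c where c: "0 < ereal c" "ereal c < (INF F \<in> ?F. INF \<eta> \<in> {0<..}. limsup (?h e F \<eta>))"
    using ereal_dense2 by blast
  have c0: "c > 0" using c(1) by simp
  have many: "\<exists>\<^sub>F j in sequentially. ereal c < ?h e F \<eta> j" if "F \<in> ?F" "\<eta> > 0" for F \<eta>
  proof -
    have "(INF F \<in> ?F. INF \<eta> \<in> {0<..}. limsup (?h e F \<eta>)) \<le> (INF \<eta> \<in> {0<..}. limsup (?h e F \<eta>))"
      using that by (intro INF_lower) auto
    also have "\<dots> \<le> limsup (?h e F \<eta>)" using that by (intro INF_lower) auto
    finally have lt: "ereal c < limsup (?h e F \<eta>)" using c(2) by (rule less_le_trans[rotated])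
    show ?thesis
    proof (rule ccontr)
      assume "\<not> ?thesis"
      then have "eventually (\<lambda>j. ?h e F \<eta> j \<le> ereal c) sequentially" by (simp add: not_frequently not_less)
      then have "limsup (?h e F \<eta>) \<le> ereal c" by (rule Limsup_bounded)
      with lt show False by simp
    qed
  qed
  have d0: "d j > 0" for j using sofic by (simp add: sofic_approximation_def)
  have perm: "\<sigma> j g permutes {1..d j}" if "g \<in> carrier G" for j g
    using sofic that by (auto simp: sofic_approximation_def sym_group_carrier Pi_iff)
  have "rich_models X (\<lambda>i. act (s i)) e c" if s: "inj s" "range s \<subseteq> carrier G" for s :: "nat \<Rightarrow> 'g"
    unfolding rich_models_def
  proof (intro allI impI)
    fix H n0 :: nat and \<kappa> \<beta> :: real assume kap: "0 < \<kappa>" and bet: "0 < \<beta>"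
    have sG: "s i \<in> carrier G" for i using s(2) by auto
    define \<zeta> where "\<zeta> = \<beta> / (real H * real H + 1)"
    have HH: "real H * real H + 1 > 0" by (meson add_nonneg_pos of_nat_0_le_iff mult_nonneg_nonneg zero_less_one)
    have zeta: "\<zeta> > 0" using bet HH by (simp add: \<zeta>_def)
    have "real H * real H * \<zeta> \<le> (real H * real H + 1) * \<zeta>" using zeta by (intro mult_right_mono) auto
    also have "\<dots> = \<beta>" using HH by (simp add: \<zeta>_def)
    finally have zb: "real H * real H * \<zeta> \<le> \<beta>" .
    define \<eta> where "\<eta> = \<kappa> * sqrt (\<beta> / (real H + 1))"
    have eta: "\<eta> > 0" using kap bet by (simp add: \<eta>_def)
    have eta2: "\<eta>\<^sup>2 / \<kappa>\<^sup>2 = \<beta> / (real H + 1)" using kap bet by (simp add: \<eta>_def power_mult_distrib)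
    have eta3: "real H * (\<eta>\<^sup>2 / \<kappa>\<^sup>2) \<le> \<beta>"
    proof -
      have "real H * \<beta> \<le> \<beta> * (real H + 1)" using bet by (simp add: algebra_simps)
      then show ?thesis unfolding eta2 by (simp add: pos_divide_le_eq)
    qed
    have F: "s ` {..H} \<in> ?F" using sG by auto
    have ev1: "eventually (\<lambda>j. n0 \<le> d j) sequentially"
      using sofic by (simp add: sofic_approximation_def filterlim_at_top)
    have ev2: "eventually (\<lambda>j. \<forall>i\<in>{..<H}. \<forall>i'\<in>{..<H}. i \<noteq> i' \<longrightarrow> 1 - \<zeta> < hamming_dist (d j) (\<sigma> j (s i)) (\<sigma> j (s i'))) sequentially"
    proof (intro eventually_ball_finite ballI)
      fix i i'
      show "eventually (\<lambda>j. i \<noteq> i' \<longrightarrow> 1 - \<zeta> < hamming_dist (d j) (\<sigma> j (s i)) (\<sigma> j (s i'))) sequentially"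
      proof (cases "i = i'")
        case False
        then have "s i \<noteq> s i'" using s(1) by (meson injD)
        then have "(\<lambda>j. hamming_dist (d j) (\<sigma> j (s i)) (\<sigma> j (s i'))) \<longlonglongrightarrow> 1"
          using sofic sG by (simp add: sofic_approximation_def)
        then have "eventually (\<lambda>j. 1 - \<zeta> < hamming_dist (d j) (\<sigma> j (s i)) (\<sigma> j (s i'))) sequentially"
          using zeta by (intro order_tendstoD(1)) auto
        then show ?thesis by eventually_elim simp
      qed simp
    qed auto
    obtain j where j1: "ereal c < ?h e (s ` {..H}) \<eta> j" and j2: "n0 \<le> d j"
      and j3: "\<forall>i\<in>{..<H}. \<forall>i'\<in>{..<H}. i \<noteq> i' \<longrightarrow> 1 - \<zeta> < hamming_dist (d j) (\<sigma> j (s i)) (\<sigma> j (s i'))"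
      using frequently_ex[OF frequently_rev_mp[OF many[OF F eta] eventually_mono[OF eventually_conj[OF ev1 ev2]], of "\<lambda>j. ereal c < ?h e (s ` {..H}) \<eta> j \<and> n0 \<le> d j \<and> (\<forall>i\<in>{..<H}. \<forall>i'\<in>{..<H}. i \<noteq> i' \<longrightarrow> 1 - \<zeta> < hamming_dist (d j) (\<sigma> j (s i)) (\<sigma> j (s i')))"]]
      by blast
    define n where "n = d j"
    have n: "n > 0" using d0 by (simp add: n_def)
    obtain S where S: "finite S" "S \<subseteq> sofic_Map X act (s ` {..H}) \<eta> n (\<sigma> j)"
      "pairwise (\<lambda>x y. e \<le> rho_inf n x y) S" "exp (c * real n) \<le> real (card S)"
      using exists_large_separated_set[OF d0 j1 c0] unfolding n_def by blast
    show "\<exists>n\<ge>n0. \<exists>\<alpha> S.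
        (\<forall>i<H. bij_betw (\<alpha> i) {1..n} {1..n}) \<and>
        real (card {v\<in>{1..n}. \<not> inj_on (\<lambda>i. \<alpha> i v) {..<H}}) \<le> \<beta> * real n \<and>
        finite S \<and> exp (c * real n) \<le> real (card S) \<and>
        (\<forall>\<phi>\<in>S. \<phi> ` {1..n} \<subseteq> X \<and>
          real (card {v\<in>{1..n}. \<exists>i<H. \<kappa> < dist (\<phi> (\<alpha> i v)) (act (s i) (\<phi> v))}) \<le> \<beta> * real n) \<and>
        (\<forall>\<phi>\<in>S. \<forall>\<psi>\<in>S. \<phi> \<noteq> \<psi> \<longrightarrow> (\<exists>v\<in>{1..n}. e \<le> dist (\<phi> v) (\<psi> v)))"
    proof (rule exI[of _ n], rule conjI, simp add: n_def j2, rule exI[of _ "\<lambda>i. \<sigma> j (s i)"], rule exI[of _ S], intro conjI ballI allI impI)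
      fix i show "bij_betw (\<sigma> j (s i)) {1..n} {1..n}"
        using permutes_imp_bij[OF perm[OF sG]] by (simp add: n_def)
    next
      let ?eq = "\<lambda>i i'. {v\<in>{1..n}. \<sigma> j (s i) v = \<sigma> j (s i') v}"
      let ?I = "{p \<in> {..<H} \<times> {..<H}. fst p \<noteq> snd p}"
      have eq: "real (card (?eq i i')) \<le> \<zeta> * real n" if "i < H" "i' < H" "i \<noteq> i'" for i i'
      proof -
        let ?ne = "{v\<in>{1..n}. \<sigma> j (s i) v \<noteq> \<sigma> j (s i') v}"
        have "1 - \<zeta> < real (card ?ne) / real n"
          using j3 that by (auto simp: hamming_dist_def n_def)
        then have 1: "(1 - \<zeta>) * real n < real (card ?ne)" using n by (simp add: pos_less_divide_eq)
        have "{1..n} = ?eq i i' \<union> ?ne" by auto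
        then have "card {1..n} = card (?eq i i' \<union> ?ne)" by (rule arg_cong)
        also have "\<dots> = card (?eq i i') + card ?ne" by (rule card_Un_disjoint) auto
        finally have "real n = real (card (?eq i i')) + real (card ?ne)" by simp
        with 1 show ?thesis by (simp add: algebra_simps)
      qed
      have "{v\<in>{1..n}. \<not> inj_on (\<lambda>i. \<sigma> j (s i) v) {..<H}} \<subseteq> (\<Union>p\<in>?I. ?eq (fst p) (snd p))"
        by (auto simp: inj_on_def)
      then have "card {v\<in>{1..n}. \<not> inj_on (\<lambda>i. \<sigma> j (s i) v) {..<H}} \<le> card (\<Union>p\<in>?I. ?eq (fst p) (snd p))"
        by (intro card_mono) auto
      also have "\<dots> \<le> (\<Sum>p\<in>?I. card (?eq (fst p) (snd p)))" by (intro card_UN_le) auto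
      finally have "real (card {v\<in>{1..n}. \<not> inj_on (\<lambda>i. \<sigma> j (s i) v) {..<H}}) \<le> (\<Sum>p\<in>?I. real (card (?eq (fst p) (snd p))))"
        by (simp flip: of_nat_sum)
      also have "\<dots> \<le> (\<Sum>p\<in>?I. \<zeta> * real n)" using eq by (intro sum_mono) auto
      also have "\<dots> = real (card ?I) * (\<zeta> * real n)" by simp
      also have "\<dots> \<le> (real H * real H) * (\<zeta> * real n)"
      proof (intro mult_right_mono)
        have "card ?I \<le> card ({..<H} \<times> {..<H})" by (intro card_mono) auto
        also have "\<dots> = H * H" by (simp add: card_cartesian_product)
        finally have "real (card ?I) \<le> real (H * H)" by (simp only: of_nat_le_iff)
        then show "real (card ?I) \<le> real H * real H" by (simp only: of_nat_mult)
      qed (use zeta in auto)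
      also have "\<dots> = real H * real H * \<zeta> * real n" by simp
      also have "\<dots> \<le> \<beta> * real n" using zb by (intro mult_right_mono) auto
      finally show "real (card {v\<in>{1..n}. \<not> inj_on (\<lambda>i. \<sigma> j (s i) v) {..<H}}) \<le> \<beta> * real n" .
    next
      fix \<phi> assume phi: "\<phi> \<in> S"
      then have M: "\<phi> \<in> sofic_Map X act (s ` {..H}) \<eta> n (\<sigma> j)" using S(2) by blast
      then show "\<phi> ` {1..n} \<subseteq> X" by (auto simp: sofic_Map_def)
      let ?b = "\<lambda>i. {v\<in>{1..n}. \<kappa> < dist (\<phi> (\<sigma> j (s i) v)) (act (s i) (\<phi> v))}"
      have b: "real (card (?b i)) \<le> \<eta>\<^sup>2 / \<kappa>\<^sup>2 * real n" if "i < H" for i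
      proof -
        have "rho_2 n (\<phi> \<circ> \<sigma> j (s i)) (\<lambda>v. act (s i) (\<phi> v)) < \<eta>" using M that by (auto simp: sofic_Map_def)
        from card_exceeding_le[OF n this kap] show ?thesis by simp
      qed
      have "{v\<in>{1..n}. \<exists>i<H. \<kappa> < dist (\<phi> (\<sigma> j (s i) v)) (act (s i) (\<phi> v))} = (\<Union>i<H. ?b i)" by auto
      then have "card {v\<in>{1..n}. \<exists>i<H. \<kappa> < dist (\<phi> (\<sigma> j (s i) v)) (act (s i) (\<phi> v))} \<le> (\<Sum>i<H. card (?b i))"
        by (simp only: card_UN_le finite_lessThan)
      then have "real (card {v\<in>{1..n}. \<exists>i<H. \<kappa> < dist (\<phi> (\<sigma> j (s i) v)) (act (s i) (\<phi> v))}) \<le> (\<Sum>i<H. real (card (?b i)))"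
        by (simp flip: of_nat_sum)
      also have "\<dots> \<le> (\<Sum>i<H. \<eta>\<^sup>2 / \<kappa>\<^sup>2 * real n)" using b by (intro sum_mono) auto
      also have "\<dots> = real H * (\<eta>\<^sup>2 / \<kappa>\<^sup>2) * real n" by simp
      also have "\<dots> \<le> \<beta> * real n" using eta3 by (intro mult_right_mono) auto
      finally show "real (card {v\<in>{1..n}. \<exists>i<H. \<kappa> < dist (\<phi> (\<sigma> j (s i) v)) (act (s i) (\<phi> v))}) \<le> \<beta> * real n" .
    next
      fix \<phi> \<psi> assume "\<phi> \<in> S" "\<psi> \<in> S" "\<phi> \<noteq> \<psi>"
      then have "e \<le> rho_inf n \<phi> \<psi>" using S(3) by (simp add: pairwise_def)
      moreover have "rho_inf n \<phi> \<psi> \<in> (\<lambda>v. dist (\<phi> v) (\<psi> v)) ` {1..n}"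
        unfolding rho_inf_def using n by (intro Max_in) auto
      ultimately show "\<exists>v\<in>{1..n}. e \<le> dist (\<phi> v) (\<psi> v)" by auto
    qed (use S in auto)
  qed
  then show ?thesis using e c0 by blast
qed

section \<open>Chaos along a sequence\<close>

lemma infinitely_repeating: "\<exists>f :: nat \<Rightarrow> nat. \<forall>n m. \<exists>k\<ge>m. f k = n"
proof (rule exI[of _ "fst \<circ> prod_decode"], intro allI)
  fix n m :: nat
  have "m \<le> prod_encode (n, m)" by (rule le_prod_encode_2)
  then show "\<exists>k\<ge>m. (fst \<circ> prod_decode) k = n" by (intro exI[of _ "prod_encode (n, m)"]) simp
qed

lemma liminf_eq_0_if_arbitrarily_small:
  fixes f :: "nat \<Rightarrow> real"
  assumes "\<And>i. 0 \<le> f i" and "\<And>k. \<exists>i\<ge>k. f i \<le> B / real (Suc k)"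
  shows "liminf (\<lambda>i. ereal (f i)) = 0"
proof (rule antisym)
  show "0 \<le> liminf (\<lambda>i. ereal (f i))"
    using assms(1) by (intro Liminf_bounded) auto
  show "liminf (\<lambda>i. ereal (f i)) \<le> 0"
  proof (rule ccontr)
    assume "\<not> ?thesis"
    then have "0 < liminf (\<lambda>i. ereal (f i))" by simp
    then obtain y where y: "0 < ereal y" "ereal y < liminf (\<lambda>i. ereal (f i))" using ereal_dense2 by blast
    then have "eventually (\<lambda>i. ereal y < ereal (f i)) sequentially" by (intro less_LiminfD)
    then obtain N where N: "\<And>i. i \<ge> N \<Longrightarrow> y < f i" by (auto simp: eventually_sequentially)
    obtain k :: nat where k: "B / y < real k" using reals_Archimedean2 by blast
    obtain i where i: "i \<ge> max N k" "f i \<le> B / real (Suc (max N k))" using assms(2) by blast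
    have "B < y * real k" using k y(1) by (simp add: field_simps)
    also have "\<dots> \<le> y * real (Suc (max N k))" using y(1) by (intro mult_left_mono) auto
    finally have "B / real (Suc (max N k)) < y" by (simp add: pos_divide_less_eq del: of_nat_Suc)
    with i(2) have "f i < y" by (rule le_less_trans)
    moreover have "N \<le> i" using i(1) by simp
    then have "y < f i" by (rule N)
    ultimately show False by (rule less_asym)
  qed
qed

lemma limsup_ge_if_frequently:
  fixes f :: "nat \<Rightarrow> real"
  assumes "\<And>m. \<exists>i\<ge>m. \<gamma> \<le> f i"
  shows "ereal \<gamma> \<le> limsup (\<lambda>i. ereal (f i))"
proof (rule ccontr)
  assume "\<not> ?thesis"
  then have "limsup (\<lambda>i. ereal (f i)) < ereal \<gamma>" by simp
  then have "eventually (\<lambda>i. ereal (f i) < ereal \<gamma>) sequentially" by (rule Limsup_lessD)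
  then obtain N where "\<And>i. i \<ge> N \<Longrightarrow> f i < \<gamma>" by (auto simp: eventually_sequentially)
  with assms[of N] show False by (meson not_le)
qed

text \<open>
The set \<open>C\<close> consists of the points that display a 0-1-sequence \<open>\<pi> x\<close>, each digit infinitely often, at the times \<open>a k\<close>
and are near \<open>z k\<close> at the times \<open>b k\<close>.  On a Cantor set on which \<open>\<pi>\<close> is injective, distinct points differ in some
digit, hence are at least \<open>\<gamma>\<close> apart infinitely often; \<open>\<delta>\<close> is \<open>\<gamma> / 2\<close> for the sake of the strict inequality.
\<close>
theorem theorem1p1:
  fixes G :: "('g, 'm) monoid_scheme"
    and d :: "nat \<Rightarrow> nat"
    and \<sigma> :: "nat \<Rightarrow> 'g \<Rightarrow> nat \<Rightarrow> nat"
    and X :: "'x::metric_space set"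
    and act :: "'g \<Rightarrow> 'x \<Rightarrow> 'x"
  assumes "sofic_group G"
    and "infinite (carrier G)"
    and "sofic_approximation G d \<sigma>"
    and "compact X"
    and "continuous_action G X act"
    and "sofic_top_entropy G d \<sigma> X act > 0"
  shows "\<exists>\<delta>>0. \<forall>s :: nat \<Rightarrow> 'g. inj s \<and> range s \<subseteq> carrier G \<longrightarrow>
    (\<exists>K\<subseteq>X. is_cantor_set K \<and>
      (\<forall>x\<in>K. \<forall>x'\<in>K. x \<noteq> x' \<longrightarrow>
        liminf (\<lambda>i. ereal (dist (act (s i) x) (act (s i) x'))) = 0 \<and>
        limsup (\<lambda>i. ereal (dist (act (s i) x) (act (s i) x'))) > ereal \<delta>))"
proof -
  from rich_models_of_entropy[OF assms(3,6)]
  obtain e c where e: "e > 0" and c: "c > 0"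
    and rich: "\<And>s :: nat \<Rightarrow> 'g. inj s \<and> range s \<subseteq> carrier G \<Longrightarrow> rich_models X (\<lambda>i. act (s i)) e c"
    by auto
  from free_and_proximal_times[OF assms(4) e c]
  obtain \<gamma> where gam: "\<gamma> > 0" and times: "\<forall>g. rich_models X g e c \<longrightarrow> (\<forall>i. continuous_on X (g i)) \<longrightarrow>
    (\<exists>p t a b z. strict_mono (a :: nat \<Rightarrow> nat) \<and> (\<forall>k. k \<le> b k) \<and>
      (\<forall>\<tau> :: nat \<Rightarrow> bool. \<exists>x\<in>X. (\<forall>k. if \<tau> k then dist (g (a k) x) p \<le> t else t + \<gamma> \<le> dist (g (a k) x) p) \<and>
        (\<forall>k. dist (g (b k) x) (z k) \<le> 1 / real (Suc k))))"
    by (elim exE conjE)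
  show ?thesis
  proof (intro exI[of _ "\<gamma> / 2"] conjI allI impI)
    show "\<gamma> / 2 > 0" using gam by simp
    fix s :: "nat \<Rightarrow> 'g" assume s: "inj s \<and> range s \<subseteq> carrier G"
    define g where "g i = act (s i)" for i
    have cont: "continuous_on X (g i)" for i
      using assms(5) s by (auto simp: continuous_action_def g_def)
    have rg: "rich_models X g e c" using rich[OF s] by (simp only: g_def[abs_def])
    from times[rule_format, OF rg cont]
    obtain p t a b z where a: "strict_mono (a :: nat \<Rightarrow> nat)" and b: "\<forall>k. k \<le> b k"
      and pts: "\<forall>\<tau> :: nat \<Rightarrow> bool. \<exists>x\<in>X. (\<forall>k. if \<tau> k then dist (g (a k) x) p \<le> t else t + \<gamma> \<le> dist (g (a k) x) p) \<and>
        (\<forall>k. dist (g (b k) x) (z k) \<le> 1 / real (Suc k))"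
      by (elim exE conjE)
    \<comment> \<open>The digit \<open>f k\<close> of the code is displayed at the time \<open>a k\<close>; \<open>h n\<close> is one index at which the digit \<open>n\<close> is displayed.\<close>
    obtain f :: "nat \<Rightarrow> nat" where f: "\<And>n m. \<exists>k\<ge>m. f k = n" using infinitely_repeating by blast
    obtain h where h: "\<And>n. f (h n) = n" using f by metis
    define \<pi> where "\<pi> x n \<longleftrightarrow> dist (g (a (h n)) x) p \<le> t" for x n
    define lo where "lo k = {x \<in> X. dist (g (a k) x) p \<le> t}" for k
    define hi where "hi k = {x \<in> X. t + \<gamma> \<le> dist (g (a k) x) p}" for k
    define nr where "nr k = {x \<in> X. dist (g (b k) x) (z k) \<le> 1 / real (Suc k)}" for k
    have clX: "closed X" using assms(4) by (rule compact_imp_closed)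
    have cd: "continuous_on X (\<lambda>x. dist (g i x) y)" for i y by (intro continuous_intros cont)
    have cl: "closed (lo k)" "closed (hi k)" "closed (nr k)" for k
      unfolding lo_def hi_def nr_def
      by (intro continuous_on_closed_Collect_le cd continuous_on_const clX)+
    define C where "C = {x \<in> X. (\<forall>k. x \<in> nr k) \<and> (\<forall>k. if \<pi> x (f k) then x \<in> lo k else x \<in> hi k)}"
    have hi_not_lo: "hi k \<inter> lo k = {}" for k using gam by (auto simp: hi_def lo_def)
    \<comment> \<open>Closedness of \<open>C\<close> becomes visible when the digit \<open>f k\<close> is read off at the index \<open>h (f k)\<close>.\<close>
    have C_alt: "C = X \<inter> (\<Inter>k. nr k) \<inter> (\<Inter>k. (lo k \<inter> lo (h (f k))) \<union> (hi k \<inter> hi (h (f k))))"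
    proof (intro subset_antisym subsetI)
      fix x assume x: "x \<in> C"
      have "x \<in> (lo k \<inter> lo (h (f k))) \<union> (hi k \<inter> hi (h (f k)))" for k
      proof -
        have "if \<pi> x (f k) then x \<in> lo k else x \<in> hi k" using x by (simp add: C_def)
        moreover have "if \<pi> x (f (h (f k))) then x \<in> lo (h (f k)) else x \<in> hi (h (f k))"
          using x unfolding C_def by blast
        ultimately show ?thesis by (cases "\<pi> x (f k)") (simp_all add: h)
      qed
      with x show "x \<in> X \<inter> (\<Inter>k. nr k) \<inter> (\<Inter>k. (lo k \<inter> lo (h (f k))) \<union> (hi k \<inter> hi (h (f k))))"
        by (simp add: C_def)
    next
      fix x assume x: "x \<in> X \<inter> (\<Inter>k. nr k) \<inter> (\<Inter>k. (lo k \<inter> lo (h (f k))) \<union> (hi k \<inter> hi (h (f k))))"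
      have "if \<pi> x (f k) then x \<in> lo k else x \<in> hi k" for k
      proof -
        have "x \<in> (lo k \<inter> lo (h (f k))) \<union> (hi k \<inter> hi (h (f k)))" using x by blast
        then show ?thesis using gam by (auto simp: \<pi>_def lo_def hi_def)
      qed
      with x show "x \<in> C" by (simp add: C_def)
    qed
    have clC: "closed ((\<Inter>k. nr k) \<inter> (\<Inter>k. (lo k \<inter> lo (h (f k))) \<union> (hi k \<inter> hi (h (f k)))))"
      by (intro closed_Int closed_INT ballI closed_Un cl)
    have compC: "compact C"
      unfolding C_alt Int_assoc using assms(4) clC by (rule compact_Int_closed)
    have coding: "coding_on C \<pi>"
      unfolding coding_on_def
    proof (intro allI)
      fix n bb
      have "{x \<in> C. \<pi> x n = bb} = C \<inter> (if bb then lo (h n) else hi (h n))"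
        using h[of n] gam by (auto simp: C_def \<pi>_def lo_def hi_def split: if_splits)
      moreover have "closed (if bb then lo (h n) else hi (h n))" using cl by simp
      ultimately show "closed {x \<in> C. \<pi> x n = bb}" using compC by (simp add: closed_Int compact_imp_closed)
    qed
    have "\<tau> \<in> \<pi> ` C" for \<tau> :: "nat \<Rightarrow> bool"
    proof -
      obtain x where x: "x \<in> X" "\<And>k. if \<tau> (f k) then dist (g (a k) x) p \<le> t else t + \<gamma> \<le> dist (g (a k) x) p"
        "\<And>k. dist (g (b k) x) (z k) \<le> 1 / real (Suc k)" using pts[rule_format, of "\<lambda>k. \<tau> (f k)"] by blast
      have px: "\<pi> x n = \<tau> n" for n using x(2)[of "h n"] h[of n] gam by (auto simp: \<pi>_def split: if_splits)
      have "x \<in> C" using x px by (auto simp: C_def nr_def lo_def hi_def split: if_splits)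
      moreover have "\<pi> x = \<tau>" using px by blast
      ultimately show ?thesis by blast
    qed
    then have onto: "\<pi> ` C = UNIV" by blast
    obtain K where K: "K \<subseteq> C" "is_cantor_set K" "inj_on \<pi> K"
      using cantor_set_of_codes[OF compC coding onto] by blast
    show "\<exists>K\<subseteq>X. is_cantor_set K \<and>
      (\<forall>x\<in>K. \<forall>x'\<in>K. x \<noteq> x' \<longrightarrow>
        liminf (\<lambda>i. ereal (dist (act (s i) x) (act (s i) x'))) = 0 \<and>
        limsup (\<lambda>i. ereal (dist (act (s i) x) (act (s i) x'))) > ereal (\<gamma> / 2))"
    proof (intro exI[of _ K] conjI ballI impI)
      show "K \<subseteq> X" using K(1) by (auto simp: C_def)
      show "is_cantor_set K" by (rule K(2))
      fix x x' assume xx: "x \<in> K" "x' \<in> K" "x \<noteq> x'"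
      have xC: "x \<in> C" "x' \<in> C" using xx K(1) by auto
      show "liminf (\<lambda>i. ereal (dist (act (s i) x) (act (s i) x'))) = 0"
      proof (rule liminf_eq_0_if_arbitrarily_small)
        fix k
        have "dist (g (b k) x) (z k) \<le> 1 / real (Suc k)" "dist (g (b k) x') (z k) \<le> 1 / real (Suc k)"
          using xC by (auto simp: C_def nr_def)
        then have "dist (g (b k) x) (g (b k) x') \<le> 2 / real (Suc k)"
          using dist_triangle2[of "g (b k) x" "g (b k) x'" "z k"] by linarith
        then show "\<exists>i\<ge>k. dist (act (s i) x) (act (s i) x') \<le> 2 / real (Suc k)"
          using b by (auto simp: g_def)
      qed simp
      have "\<pi> x \<noteq> \<pi> x'" using inj_onD[OF K(3), of x x'] xx by blast
      then obtain n where n: "\<pi> x n \<noteq> \<pi> x' n" by (auto simp: fun_eq_iff)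
      have "ereal \<gamma> \<le> limsup (\<lambda>i. ereal (dist (act (s i) x) (act (s i) x')))"
      proof (rule limsup_ge_if_frequently)
        fix m
        obtain k where k: "k \<ge> m" "f k = n" using f by blast
        have "if \<pi> x n then x \<in> lo k else x \<in> hi k" "if \<pi> x' n then x' \<in> lo k else x' \<in> hi k"
          using xC k(2) by (auto simp: C_def)
        with n have "x \<in> lo k \<and> x' \<in> hi k \<or> x \<in> hi k \<and> x' \<in> lo k" by (auto split: if_splits)
        then have "\<gamma> \<le> dist (g (a k) x) (g (a k) x')"
          using dist_triangle[of "g (a k) x" p "g (a k) x'"] dist_triangle[of "g (a k) x'" p "g (a k) x"]
          by (auto simp: lo_def hi_def dist_commute)
        moreover have "m \<le> a k" using seq_suble[OF a, of k] k(1) by linarith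
        ultimately show "\<exists>i\<ge>m. \<gamma> \<le> dist (act (s i) x) (act (s i) x')" by (auto simp: g_def)
      qed
      moreover have "ereal (\<gamma> / 2) < ereal \<gamma>" using gam by simp
      ultimately show "limsup (\<lambda>i. ereal (dist (act (s i) x) (act (s i) x'))) > ereal (\<gamma> / 2)"
        by (rule less_le_trans[rotated])
    qed
  qed
qed

end
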